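(* Let $K$ be a reduced commutative ring with $\frac12\in K$. Then: 1. $G_{\mathbb Z_2\text{-}gr}=\Gamma\rtimes\mathrm{GL}_n(K)^{op}$. 2. $G=\Omega\rtimes G_{\mathbb Z_2\text{-}gr}$. 3. $\mathrm{Out}(\Lambda_n)\simeq G_{\mathbb Z_2\text{-}gr}$.
   Context: $\Lambda_n=\Lambda_n(K)$ is the Grassmann $K$-algebra generated freely over $K$ by $x_1,\dots,x_n$ subject to $x_i^2=0$, $x_ix_j=-x_jx_i$ ($i\ne j$); it is graded by total degree with components $\Lambda_{n,d}$; $\mathfrak m=\bigoplus_{d\ge1}\Lambda_{n,d}$; $\Lambda_n^{ev}$ and $\Lambda_n^{od}$ are the sums of the even, respectively odd, degree components. A commutative ring is reduced if $0$ is its only nilpotent element. $G=\mathrm{Aut}_K(\Lambda_n)$ is the group of $K$-algebra automorphisms of $\Lambda_n$. $G_{\mathbb Z_2\text{-}gr}=\{\sigma\in G\mid\sigma(\Lambda_n^{ev})=\Lambda_n^{ev},\ \sigma(\Lambda_n^{od})=\Lambda_n^{od}\}$. $\Gamma=\{\sigma\in G\mid\sigma(x_i)-x_i\in\Lambda_n^{od}\cap\mathfrak m^3\text{ for all }i\}$. For a unit $u\in\Lambda_n$, $\omega_u(x)=uxu^{-1}$ is an inner automorphism; $\Omega=\{\omega_{1+a}\mid a\in\Lambda_n^{od}\}$. $\mathrm{Inn}(\Lambda_n)=\{\omega_u\mid u \text{ a unit of } \Lambda_n\}$ and $\mathrm{Out}(\Lambda_n)=G/\mathrm{Inn}(\Lambda_n)$.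 $\mathrm{GL}_n(K)^{op}$ denotes the subgroup $\{\sigma_A\mid A\in\mathrm{GL}_n(K)\}$ of $G$, where $\sigma_A(x_i)=\sum_{j=1}^na_{ij}x_j$ for $A=(a_{ij})$. $N\rtimes H$ denotes the internal semidirect product with $N$ normal. *)

theory Defs
  imports
    "HOL-Analysis.Finite_Cartesian_Product"
    "HOL-Analysis.Cartesian_Space"
    "HOL-Library.Poly_Mapping"
    "HOL-Algebra.Coset"
begin

section \<open>The Grassmann algebra\<close>

text \<open>
  Words under concatenation form the free monoid; written additively, its monoid algebra
  \<^typ>\<open>'n list \<Rightarrow>\<^sub>0 'k\<close> (multiplication from \<^theory>\<open>HOL-Library.Poly_Mapping\<close>) is the free
  associative unital \<open>'k\<close>-algebra on generators indexed by \<open>'n\<close>.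
\<close>

instantiation list :: (type) monoid_add
begin

definition zero_list :: "'a list" where "zero_list = []"

definition plus_list :: "'a list \<Rightarrow> 'a list \<Rightarrow> 'a list" where "plus_list = append"

instance by standard (simp_all add: zero_list_def plus_list_def)

end

abbreviation free_gen :: "'n \<Rightarrow> ('n list \<Rightarrow>\<^sub>0 'k::comm_ring_1)"
  where "free_gen i \<equiv> Poly_Mapping.single [i] 1"

inductive_set grass_ideal :: "('n list \<Rightarrow>\<^sub>0 'k::comm_ring_1) set" where
  square: "free_gen i * free_gen i \<in> grass_ideal"
| anticomm: "i \<noteq> j \<Longrightarrow> free_gen i * free_gen j + free_gen j * free_gen i \<in> grass_ideal"
| zero: "0 \<in> grass_ideal"
| add: "p \<in> grass_ideal \<Longrightarrow> q \<in> grass_ideal \<Longrightarrow> p + q \<in> grass_ideal"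
| mult_left: "p \<in> grass_ideal \<Longrightarrow> r * p \<in> grass_ideal"
| mult_right: "p \<in> grass_ideal \<Longrightarrow> p * r \<in> grass_ideal"

lemma grass_ideal_uminus: "p \<in> grass_ideal \<Longrightarrow> - p \<in> grass_ideal"
  using grass_ideal.mult_left[of p "- 1"] by simp

lemma grass_ideal_diff: "p \<in> grass_ideal \<Longrightarrow> q \<in> grass_ideal \<Longrightarrow> p - q \<in> grass_ideal"
  using grass_ideal.add[of p "- q"] grass_ideal_uminus[of q] by simp

definition grass_rel :: "('n list \<Rightarrow>\<^sub>0 'k::comm_ring_1) \<Rightarrow> ('n list \<Rightarrow>\<^sub>0 'k) \<Rightarrow> bool"
  where "grass_rel p q \<longleftrightarrow> p - q \<in> grass_ideal"

lemma equivp_grass_rel: "equivp grass_rel"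
proof (rule equivpI)
  show "reflp grass_rel"
    by (simp add: reflp_def grass_rel_def grass_ideal.zero)
  show "symp grass_rel"
    using grass_ideal_uminus by (force simp: symp_def grass_rel_def)
  show "transp grass_rel"
    using grass_ideal.add by (force simp: transp_def grass_rel_def)
qed

quotient_type (overloaded) ('k, 'n) grassmann = "'n list \<Rightarrow>\<^sub>0 'k::comm_ring_1" / grass_rel
  by (rule equivp_grass_rel)

lemma lookup_zero_mult:
  fixes p q :: "'n list \<Rightarrow>\<^sub>0 'k::comm_ring_1"
  shows "Poly_Mapping.lookup (p * q) [] = Poly_Mapping.lookup p [] * Poly_Mapping.lookup q []"
proof -
  have *: "([] = u + v) \<longleftrightarrow> u = [] \<and> v = []" for u v :: "'n list"
    by (auto simp: plus_list_def)
  have inner: "Sum_any (\<lambda>r. Poly_Mapping.lookup q r when [] = l + r)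
      = (Poly_Mapping.lookup q [] when l = [])" for l
  proof -
    have "(\<lambda>r. Poly_Mapping.lookup q r when [] = l + r)
        = (\<lambda>r. (Poly_Mapping.lookup q r when l = []) when r = [])"
      by (auto simp: * when_def fun_eq_iff)
    then show ?thesis by (simp only: Sum_any_when_equal)
  qed
  have "(\<lambda>l. Poly_Mapping.lookup p l * (Poly_Mapping.lookup q [] when l = []))
      = (\<lambda>l. (Poly_Mapping.lookup p l * Poly_Mapping.lookup q []) when l = [])"
    by (auto simp: when_def fun_eq_iff)
  then show ?thesis
    by (simp only: lookup_mult inner Sum_any_when_equal)
qed

lemma lookup_grass_ideal: "p \<in> grass_ideal \<Longrightarrow> Poly_Mapping.lookup p [] = 0"
  by (induction rule: grass_ideal.induct) (simp_all add: lookup_zero_mult lookup_add lookup_single)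

instantiation grassmann :: (comm_ring_1, type) ring_1
begin

lift_definition zero_grassmann :: "('a, 'b) grassmann" is 0 .

lift_definition one_grassmann :: "('a, 'b) grassmann" is 1 .

lift_definition plus_grassmann :: "('a, 'b) grassmann \<Rightarrow> ('a, 'b) grassmann \<Rightarrow> ('a, 'b) grassmann"
  is "(+)"
proof -
  fix p p' q q' :: "'b list \<Rightarrow>\<^sub>0 'a"
  assume "grass_rel p p'" "grass_rel q q'"
  then show "grass_rel (p + q) (p' + q')"
    unfolding grass_rel_def using grass_ideal.add[of "p - p'" "q - q'"] by (simp add: algebra_simps)
qed

lift_definition minus_grassmann :: "('a, 'b) grassmann \<Rightarrow> ('a, 'b) grassmann \<Rightarrow> ('a, 'b) grassmann"
  is "(-)"
proof -
  fix p p' q q' :: "'b list \<Rightarrow>\<^sub>0 'a"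
  assume "grass_rel p p'" "grass_rel q q'"
  then show "grass_rel (p - q) (p' - q')"
    unfolding grass_rel_def using grass_ideal_diff[of "p - p'" "q - q'"] by (simp add: algebra_simps)
qed

lift_definition uminus_grassmann :: "('a, 'b) grassmann \<Rightarrow> ('a, 'b) grassmann" is "uminus"
proof -
  fix p p' :: "'b list \<Rightarrow>\<^sub>0 'a"
  assume "grass_rel p p'"
  then show "grass_rel (- p) (- p')"
    unfolding grass_rel_def using grass_ideal_uminus[of "p - p'"] by (simp add: algebra_simps)
qed

lift_definition times_grassmann :: "('a, 'b) grassmann \<Rightarrow> ('a, 'b) grassmann \<Rightarrow> ('a, 'b) grassmann"
  is "(*)"
proof -
  fix p p' q q' :: "'b list \<Rightarrow>\<^sub>0 'a"
  assume "grass_rel p p'" "grass_rel q q'"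
  then have "(p - p') * q + p' * (q - q') \<in> grass_ideal"
    unfolding grass_rel_def by (intro grass_ideal.add grass_ideal.mult_left grass_ideal.mult_right)
  then show "grass_rel (p * q) (p' * q')"
    unfolding grass_rel_def by (simp add: algebra_simps)
qed

instance
proof
  fix a b c :: "('a, 'b) grassmann"
  have refl: "grass_rel p p" for p :: "'b list \<Rightarrow>\<^sub>0 'a"
    by (simp add: grass_rel_def grass_ideal.zero)
  show "a + b + c = a + (b + c)" by transfer (simp add: refl add.assoc)
  show "a + b = b + a" by transfer (simp add: refl add.commute)
  show "0 + a = a" by transfer (simp add: refl)
  show "- a + a = 0" by transfer (simp add: refl)
  show "a - b = a + - b" by transfer (simp add: refl)
  show "a * b * c = a * (b * c)" by transfer (simp add: refl mult.assoc)
  show "(a + b) * c = a * c + b * c" by transfer (simp add: refl distrib_right)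
  show "a * (b + c) = a * b + a * c" by transfer (simp add: refl distrib_left)
  show "1 * a = a" by transfer (simp add: refl)
  show "a * 1 = a" by transfer (simp add: refl)
  show "(0::('a, 'b) grassmann) \<noteq> 1"
  proof transfer
    show "\<not> grass_rel (0::'b list \<Rightarrow>\<^sub>0 'a) 1"
      using lookup_grass_ideal[of "0 - 1 :: 'b list \<Rightarrow>\<^sub>0 'a"]
      by (auto simp: grass_rel_def lookup_one zero_list_def)
  qed
qed

end

lift_definition grass_scale :: "'k::comm_ring_1 \<Rightarrow> ('k, 'n) grassmann \<Rightarrow> ('k, 'n) grassmann"
  is "\<lambda>c p. Poly_Mapping.single 0 c * p"
proof -
  fix c :: 'k and p q :: "'n list \<Rightarrow>\<^sub>0 'k"
  assume "grass_rel p q"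
  then show "grass_rel (Poly_Mapping.single 0 c * p) (Poly_Mapping.single 0 c * q)"
    unfolding grass_rel_def
    by (metis grass_ideal.mult_left right_diff_distrib)
qed

lift_definition grass_gen :: "'n \<Rightarrow> ('k::comm_ring_1, 'n) grassmann" is free_gen .

lemma grass_gen_square: "grass_gen i * grass_gen i = 0"
  by transfer (simp add: grass_rel_def grass_ideal.square)

lemma grass_gen_anticomm:
  assumes "i \<noteq> j"
  shows "grass_gen i * grass_gen j = - (grass_gen j * grass_gen i)"
  using assms by transfer (simp add: grass_rel_def grass_ideal.anticomm)

global_interpretation grass: module grass_scale
proof
  have refl: "grass_rel p p" for p :: "'b list \<Rightarrow>\<^sub>0 'a::comm_ring_1"
    by (simp add: grass_rel_def grass_ideal.zero)
  fix a b :: 'a and x y :: "('a, 'b) grassmann"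
  show "grass_scale a (x + y) = grass_scale a x + grass_scale a y"
    by transfer (simp add: refl distrib_left)
  show "grass_scale (a + b) x = grass_scale a x + grass_scale b x"
    by transfer (simp add: refl single_add distrib_right)
  show "grass_scale a (grass_scale b x) = grass_scale (a * b) x"
    by transfer (simp add: refl mult_single flip: mult.assoc)
  show "grass_scale 1 x = x"
    by transfer (simp add: refl)
qed


section \<open>Grading\<close>

definition grass_mono :: "'n list \<Rightarrow> ('k::comm_ring_1, 'n) grassmann"
  where "grass_mono w = prod_list (map grass_gen w)"

definition grass_comp :: "nat \<Rightarrow> ('k::comm_ring_1, 'n) grassmann set"
  where "grass_comp d = module.span grass_scale {grass_mono w | w. length w = d}"

text \<open>The span of a union of submodules is their sum.\<close>

definition grass_ev :: "('k::comm_ring_1, 'n) grassmann set"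
  where "grass_ev = module.span grass_scale (\<Union>d\<in>{d. even d}. grass_comp d)"

definition grass_od :: "('k::comm_ring_1, 'n) grassmann set"
  where "grass_od = module.span grass_scale (\<Union>d\<in>{d. odd d}. grass_comp d)"

definition grass_max :: "('k::comm_ring_1, 'n) grassmann set"
  where "grass_max = module.span grass_scale (\<Union>d\<in>{d. d \<ge> 1}. grass_comp d)"

definition ideal_mult ::
    "('k::comm_ring_1, 'n) grassmann set \<Rightarrow> ('k, 'n) grassmann set \<Rightarrow> ('k, 'n) grassmann set"
  where "ideal_mult I J = module.span grass_scale {a * b | a b. a \<in> I \<and> b \<in> J}"


section \<open>Automorphism groups\<close>

type_synonym ('k, 'n) grass_endo = "('k, 'n) grassmann \<Rightarrow> ('k, 'n) grassmann"

definition grass_Aut :: "('k::comm_ring_1, 'n) grass_endo monoid"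
  where "grass_Aut =
    \<lparr>carrier = {\<sigma>. bij \<sigma> \<and> module_hom grass_scale grass_scale \<sigma> \<and>
                  \<sigma> 1 = 1 \<and> (\<forall>a b. \<sigma> (a * b) = \<sigma> a * \<sigma> b)},
     monoid.mult = (\<circ>), one = id\<rparr>"

definition grass_Z2gr :: "('k::comm_ring_1, 'n) grass_endo set"
  where "grass_Z2gr =
    {\<sigma> \<in> carrier grass_Aut. \<sigma> ` grass_ev = grass_ev \<and> \<sigma> ` grass_od = grass_od}"

definition grass_Gamma :: "('k::comm_ring_1, 'n) grass_endo set"
  where "grass_Gamma =
    {\<sigma> \<in> carrier grass_Aut. \<forall>i. \<sigma> (grass_gen i) - grass_gen i
       \<in> grass_od \<inter> ideal_mult grass_max (ideal_mult grass_max grass_max)}"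

text \<open>
  An algebra endomorphism is determined by its values on the generators, so each \<open>A\<close>
  contributes exactly one automorphism.
\<close>

definition grass_GL_op :: "('k::comm_ring_1, 'n::finite) grass_endo set"
  where "grass_GL_op =
    {\<sigma> \<in> carrier grass_Aut. \<exists>A :: 'k^'n^'n. invertible A \<and>
       (\<forall>i. \<sigma> (grass_gen i) = (\<Sum>j\<in>UNIV. grass_scale (A $ i $ j) (grass_gen j)))}"

definition grass_unit :: "('k::comm_ring_1, 'n) grassmann \<Rightarrow> bool"
  where "grass_unit u \<longleftrightarrow> (\<exists>v. u * v = 1 \<and> v * u = 1)"

definition grass_inverse :: "('k::comm_ring_1, 'n) grassmann \<Rightarrow> ('k, 'n) grassmann"
  where "grass_inverse u = (THE v. u * v = 1 \<and> v * u = 1)"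

definition grass_inner :: "('k::comm_ring_1, 'n) grassmann \<Rightarrow> ('k, 'n) grass_endo"
  where "grass_inner u = (\<lambda>x. u * x * grass_inverse u)"

text \<open>Every \<open>1 + a\<close> with \<open>a\<close> odd is a unit, since \<open>a\<close> is nilpotent.\<close>

definition grass_Omega :: "('k::comm_ring_1, 'n) grass_endo set"
  where "grass_Omega = {grass_inner (1 + a) | a. a \<in> grass_od}"

definition grass_Inn :: "('k::comm_ring_1, 'n) grass_endo set"
  where "grass_Inn = {grass_inner u | u. grass_unit u}"

definition grass_Out :: "('k::comm_ring_1, 'n) grass_endo set monoid"
  where "grass_Out = grass_Aut Mod grass_Inn"

definition internal_semidirect :: "('a, 'b) monoid_scheme \<Rightarrow> 'a set \<Rightarrow> 'a set \<Rightarrow> bool"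
  where "internal_semidirect G N H \<longleftrightarrow>
    N \<lhd> G \<and> subgroup H G \<and> N \<inter> H = {\<one>\<^bsub>G\<^esub>} \<and> N <#>\<^bsub>G\<^esub> H = carrier G"

lemma carrier_grass_Aut:
  "\<sigma> \<in> carrier grass_Aut \<longleftrightarrow> bij \<sigma> \<and> module_hom grass_scale grass_scale \<sigma> \<and>
     \<sigma> 1 = 1 \<and> (\<forall>a b. \<sigma> (a * b) = \<sigma> a * \<sigma> b)"
  by (simp add: grass_Aut_def)

lemma mult_grass_Aut [simp]: "\<sigma> \<otimes>\<^bsub>grass_Aut\<^esub> \<tau> = \<sigma> \<circ> \<tau>"
  by (simp add: grass_Aut_def)

lemma one_grass_Aut [simp]: "\<one>\<^bsub>grass_Aut\<^esub> = id"
  by (simp add: grass_Aut_def)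

lemma group_grass_Aut: "group (grass_Aut :: ('k::comm_ring_1, 'n) grass_endo monoid)"
proof (rule groupI)
  fix \<sigma> \<tau> :: "('k, 'n) grass_endo"
  assume "\<sigma> \<in> carrier grass_Aut" "\<tau> \<in> carrier grass_Aut"
  then show "\<sigma> \<otimes>\<^bsub>grass_Aut\<^esub> \<tau> \<in> carrier grass_Aut"
    by (auto simp: carrier_grass_Aut bij_comp module_hom_iff)
next
  show "\<one>\<^bsub>grass_Aut\<^esub> \<in> carrier (grass_Aut :: ('k, 'n) grass_endo monoid)"
    by (auto simp: carrier_grass_Aut module_hom_iff grass.module_axioms)
next
  fix \<sigma> :: "('k, 'n) grass_endo"
  assume "\<sigma> \<in> carrier grass_Aut"
  then have \<sigma>: "bij \<sigma>" "\<sigma> 1 = 1" "\<And>a b. \<sigma> (a * b) = \<sigma> a * \<sigma> b"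
      "\<And>a b. \<sigma> (a + b) = \<sigma> a + \<sigma> b" "\<And>c a. \<sigma> (grass_scale c a) = grass_scale c (\<sigma> a)"
    by (auto simp: carrier_grass_Aut module_hom_iff)
  let ?\<tau> = "inv_into UNIV \<sigma>"
  have st: "\<sigma> (?\<tau> x) = x" and ts: "?\<tau> (\<sigma> x) = x" for x
    using \<sigma>(1) by (simp_all add: bij_is_surj surj_f_inv_f bij_is_inj)
  have inj: "\<sigma> x = \<sigma> y \<Longrightarrow> x = y" for x y
    using \<sigma>(1) by (metis ts)
  have "bij ?\<tau>" using \<sigma>(1) by (rule bij_imp_bij_inv)
  moreover have "module_hom grass_scale grass_scale ?\<tau>"
    by (auto simp: module_hom_iff grass.module_axioms st \<sigma> intro: inj)
  moreover have "?\<tau> 1 = 1" by (rule inj) (simp add: st \<sigma>)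
  moreover have "?\<tau> (a * b) = ?\<tau> a * ?\<tau> b" for a b by (rule inj) (simp add: st \<sigma>)
  ultimately have "?\<tau> \<in> carrier grass_Aut" by (simp add: carrier_grass_Aut)
  moreover have "?\<tau> \<otimes>\<^bsub>grass_Aut\<^esub> \<sigma> = \<one>\<^bsub>grass_Aut\<^esub>" by (simp add: fun_eq_iff ts)
  ultimately show "\<exists>\<tau>\<in>carrier grass_Aut. \<tau> \<otimes>\<^bsub>grass_Aut\<^esub> \<sigma> = \<one>\<^bsub>grass_Aut\<^esub>" by blast
qed (simp_all add: comp_assoc)

lemma grass_inverse_eq:
  assumes "u * v = 1" "v * u = 1"
  shows "grass_inverse u = v"
  unfolding grass_inverse_def
proof (rule the_equality)
  fix w assume "u * w = 1 \<and> w * u = 1"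
  then show "w = v" using assms by (metis mult.assoc mult.left_neutral mult.right_neutral)
qed (use assms in simp)

lemma grass_inner_eq:
  assumes "u * v = 1" "v * u = 1"
  shows "grass_inner u x = u * x * v"
  using grass_inverse_eq[OF assms] by (simp add: grass_inner_def)

lemma grass_scale_mult:
  "grass_scale c x * y = grass_scale c (x * y)"
  "x * grass_scale c y = grass_scale c (x * y)"
proof -
  have comm: "p * Poly_Mapping.single 0 c = Poly_Mapping.single 0 c * p"
    for p :: "'b list \<Rightarrow>\<^sub>0 'a" and c
  proof (induction p rule: update_induct)
    case const
    show ?case by simp
  next
    case (update f a b)
    have "Poly_Mapping.update a b f = f + Poly_Mapping.single a b"
      using update.hyps
      by (intro poly_mapping_eqI) (auto simp: lookup_update lookup_add lookup_single when_def in_keys_iff)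
    with update.IH show ?case
      by (simp add: distrib_left distrib_right mult_single mult.commute)
  qed
  show "grass_scale c x * y = grass_scale c (x * y)"
    by transfer (simp add: grass_rel_def grass_ideal.zero mult.assoc)
  show "x * grass_scale c y = grass_scale c (x * y)"
    by transfer (simp add: grass_rel_def grass_ideal.zero comm flip: mult.assoc)
qed

lemma grass_inner_Aut:
  assumes "grass_unit u"
  shows "grass_inner u \<in> carrier grass_Aut"
proof -
  obtain v where v: "u * v = 1" "v * u = 1" using assms by (auto simp: grass_unit_def)
  have eq: "grass_inner u x = u * x * v" for x by (rule grass_inner_eq[OF v])
  have vu: "v * (u * x) = x" "u * (v * x) = x" for x
    using v by (simp_all flip: mult.assoc)
  have "bij (grass_inner u)"
    by (rule bij_betw_byWitness[where f' = "\<lambda>x. v * x * u"]) (auto simp: eq mult.assoc vu v)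
  moreover have "module_hom grass_scale grass_scale (grass_inner u)"
    by (auto simp: module_hom_iff grass.module_axioms eq distrib_left distrib_right grass_scale_mult)
  ultimately show ?thesis by (simp add: carrier_grass_Aut eq mult.assoc vu v)
qed

lemma normal_grass_Inn: "(grass_Inn :: ('k::comm_ring_1, 'n) grass_endo set) \<lhd> grass_Aut"
proof -
  interpret G: group "grass_Aut :: ('k, 'n) grass_endo monoid" by (rule group_grass_Aut)
  have comp: "grass_inner u \<circ> grass_inner u' = grass_inner (u * u')"
    if "u * v = 1" "v * u = 1" "u' * v' = 1" "v' * u' = 1"
    for u v u' v' :: "('k, 'n) grassmann"
  proof -
    have p: "(u * u') * (v' * v) = 1" "(v' * v) * (u * u') = 1"
      using that by (metis mult.assoc mult.right_neutral)+
    show ?thesis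
      by (simp add: fun_eq_iff grass_inner_eq[OF that(1,2)] grass_inner_eq[OF that(3,4)]
          grass_inner_eq[OF p] mult.assoc)
  qed
  have unit: "grass_inner u \<in> grass_Inn" if "u * v = 1" "v * u = 1"
    for u v :: "('k, 'n) grassmann"
    using that by (auto simp: grass_Inn_def grass_unit_def)
  have id: "grass_inner 1 = (id :: ('k, 'n) grass_endo)"
    using grass_inner_eq[of "1 :: ('k, 'n) grassmann" 1] by (simp add: fun_eq_iff)
  have inv: "inv\<^bsub>grass_Aut\<^esub> (grass_inner u) = grass_inner v" if "u * v = 1" "v * u = 1"
    for u v :: "('k, 'n) grassmann"
    by (rule G.inv_equality)
      (use that in \<open>auto simp: comp[OF that(2,1) that] id grass_unit_def intro!: grass_inner_Aut\<close>)
  have "subgroup (grass_Inn :: ('k, 'n) grass_endo set) grass_Aut"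
  proof
    show "(grass_Inn :: ('k, 'n) grass_endo set) \<subseteq> carrier grass_Aut"
      by (auto simp: grass_Inn_def grass_inner_Aut)
    show "\<one>\<^bsub>grass_Aut\<^esub> \<in> (grass_Inn :: ('k, 'n) grass_endo set)"
      using unit[of 1 1] by (simp add: id)
  next
    fix \<sigma> \<tau> :: "('k, 'n) grass_endo" assume "\<sigma> \<in> grass_Inn" "\<tau> \<in> grass_Inn"
    then obtain u v u' v' where *: "\<sigma> = grass_inner u" "\<tau> = grass_inner u'"
        "u * v = 1" "v * u = 1" "u' * v' = 1" "v' * u' = 1"
      by (auto simp: grass_Inn_def grass_unit_def)
    then have "(u * u') * (v' * v) = 1" "(v' * v) * (u * u') = 1"
      by (metis mult.assoc mult.right_neutral)+
    then show "\<sigma> \<otimes>\<^bsub>grass_Aut\<^esub> \<tau> \<in> grass_Inn"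
      using * by (simp add: comp unit)
  next
    fix \<sigma> :: "('k, 'n) grass_endo" assume "\<sigma> \<in> grass_Inn"
    then obtain u v where "\<sigma> = grass_inner u" "u * v = 1" "v * u = 1"
      by (auto simp: grass_Inn_def grass_unit_def)
    then show "inv\<^bsub>grass_Aut\<^esub> \<sigma> \<in> grass_Inn" by (simp add: inv unit)
  qed
  moreover have "\<sigma> \<otimes>\<^bsub>grass_Aut\<^esub> \<tau> \<otimes>\<^bsub>grass_Aut\<^esub> inv\<^bsub>grass_Aut\<^esub> \<sigma> \<in> grass_Inn"
    if \<sigma>: "\<sigma> \<in> carrier grass_Aut" and \<tau>: "\<tau> \<in> grass_Inn" for \<sigma> \<tau> :: "('k, 'n) grass_endo"
  proof -
    obtain u v where u: "\<tau> = grass_inner u" "u * v = 1" "v * u = 1"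
      using \<tau> by (auto simp: grass_Inn_def grass_unit_def)
    have hom: "\<sigma> 1 = 1" "\<And>a b. \<sigma> (a * b) = \<sigma> a * \<sigma> b"
      using \<sigma> by (auto simp: carrier_grass_Aut)
    have s: "\<sigma> u * \<sigma> v = 1" "\<sigma> v * \<sigma> u = 1"
      using u by (metis hom)+
    have "\<sigma> \<circ> inv\<^bsub>grass_Aut\<^esub> \<sigma> = id"
      using G.r_inv[OF \<sigma>] by simp
    then have si: "\<sigma> ((inv\<^bsub>grass_Aut\<^esub> \<sigma>) x) = x" for x
      by (metis comp_apply id_apply)
    have "\<sigma> \<circ> \<tau> \<circ> inv\<^bsub>grass_Aut\<^esub> \<sigma> = grass_inner (\<sigma> u)"
      by (simp add: fun_eq_iff u(1) grass_inner_eq[OF u(2,3)] grass_inner_eq[OF s] hom si)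
    then show ?thesis using unit[OF s] by simp
  qed
  ultimately show ?thesis by (simp add: G.normal_inv_iff)
qed

end

theory Submission
  imports Defs
begin

text \<open>
  Reducedness forces an automorphism \<open>\<sigma>\<close> to preserve the augmentation, so it has a linear part,
  which is multiplicative; a graded automorphism lies in \<open>\<Gamma>\<close> exactly when its linear part is
  trivial. For the second claim write \<open>\<sigma> x\<^sub>i = e\<^sub>i + u\<^sub>i\<close> with \<open>e\<^sub>i\<close> even and \<open>u\<^sub>i\<close> odd. Conjugation by
  \<open>1 + c\<close> with \<open>c\<close> odd fixes even elements and sends an odd \<open>u\<close> to \<open>u + 2 c u\<close>, so one has to find
  an odd \<open>a\<close> with \<open>e\<^sub>i = a u\<^sub>i\<close> for all \<open>i\<close>. The defining relations give \<open>e\<^sub>i e\<^sub>j = 0\<close> and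
  \<open>e\<^sub>i u\<^sub>j = - e\<^sub>j u\<^sub>i\<close>, so \<open>f\<^sub>i = \<sigma>\<^sup>-\<^sup>1 e\<^sub>i\<close> satisfies \<open>x\<^sub>i f\<^sub>j + x\<^sub>j f\<^sub>i = 0\<close>, whence \<open>f\<^sub>i = x\<^sub>i b\<close> for a
  common \<open>b\<close>. Splitting \<open>\<sigma> b = p + q\<close> by parity gives \<open>e\<^sub>i (1 - p) = u\<^sub>i q\<close> with \<open>p\<close> nilpotent.
  Finally every inner automorphism lies in \<open>\<Omega>\<close>: if \<open>w = e + u\<close> is a unit, then so is
  \<open>e\<^sup>2 = (e + u) (e - u)\<close>, and the central factor \<open>e\<close> of \<open>w = e (1 + e\<^sup>-\<^sup>1 u)\<close> acts trivially.
\<close>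

section \<open>Grassmann modules\<close>

lemma update_eq_add_single:
  "w \<notin> Poly_Mapping.keys p \<Longrightarrow> Poly_Mapping.update w c p = p + Poly_Mapping.single w c"
  by (intro poly_mapping_eqI)
    (auto simp: lookup_update lookup_add lookup_single when_def in_keys_iff)

text \<open>
  The universal property of the Grassmann algebra in the form used for all constructions below:
  a family of linear operators with the defining relations makes a module into a module over it.
\<close>

locale grass_module = module scl
  for scl :: "'k::comm_ring_1 \<Rightarrow> 'm::ab_group_add \<Rightarrow> 'm" +
  fixes Y :: "'n \<Rightarrow> 'm \<Rightarrow> 'm"
  assumes Y_add: "Y i (x + y) = Y i x + Y i y"
    and Y_scale: "Y i (scl c x) = scl c (Y i x)"
    and Y_square: "Y i (Y i x) = 0"
    and Y_anticomm: "i \<noteq> j \<Longrightarrow> Y i (Y j x) + Y j (Y i x) = 0"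
begin

text \<open>The first letter of a word acts last, so concatenation of words becomes composition of
  operators.\<close>

definition free_act :: "('n list \<Rightarrow>\<^sub>0 'k) \<Rightarrow> 'm \<Rightarrow> 'm"
  where "free_act p x = (\<Sum>w\<in>Poly_Mapping.keys p. scl (Poly_Mapping.lookup p w) (foldr Y w x))"

text \<open>An arbitrary representative is used; \<open>act_abs\<close> shows that the choice does
  not matter.\<close>

definition act :: "('k, 'n) grassmann \<Rightarrow> 'm \<Rightarrow> 'm"
  where "act a = free_act (rep_grassmann a)"

lemma foldr_add: "foldr Y w (x + y) = foldr Y w x + foldr Y w y"
  by (induction w) (simp_all add: Y_add)

lemma foldr_scale: "foldr Y w (scl c x) = scl c (foldr Y w x)"
  by (induction w) (simp_all add: Y_scale)

lemma free_act_superset: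
  assumes "finite A" "Poly_Mapping.keys p \<subseteq> A"
  shows "free_act p x = (\<Sum>w\<in>A. scl (Poly_Mapping.lookup p w) (foldr Y w x))"
  unfolding free_act_def using assms
  by (intro sum.mono_neutral_left) (auto simp: in_keys_iff)

lemma free_act_add: "free_act (p + q) x = free_act p x + free_act q x"
proof -
  let ?A = "Poly_Mapping.keys p \<union> Poly_Mapping.keys q"
  have "Poly_Mapping.keys (p + q) \<subseteq> ?A" by (rule keys_add)
  then show ?thesis
    by (simp add: free_act_superset[where A = ?A] lookup_add scale_left_distrib sum.distrib)
qed

lemma free_act_single: "free_act (Poly_Mapping.single w c) x = scl c (foldr Y w x)"
  by (simp add: free_act_superset[where A = "{w}"])

lemma free_act_zero: "free_act 0 x = 0"
  by (simp add: free_act_def)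

lemma free_act_add_right: "free_act p (x + y) = free_act p x + free_act p y"
  by (simp add: free_act_def foldr_add scale_right_distrib sum.distrib)

lemma free_act_scale_right: "free_act p (scl c x) = scl c (free_act p x)"
  by (simp add: free_act_def foldr_scale scale_sum_right mult.commute)

lemma free_act_zero_right: "free_act p 0 = 0"
  using free_act_add_right[of p 0 0] by simp

text \<open>Biadditivity reduces the claim to two words, where \<open>foldr\<close> over a
  concatenation is a composition.\<close>

lemma free_act_mult: "free_act (p * q) x = free_act p (free_act q x)"
proof (induction p rule: update_induct)
  case const
  show ?case by (simp add: free_act_zero)
next
  case (update p w c)
  have "free_act (Poly_Mapping.single w c * q) x
      = free_act (Poly_Mapping.single w c) (free_act q x)"
  proof (induction q rule: update_induct)
    case const
    show ?case by (simp add: free_act_zero free_act_zero_right)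
  next
    case (update q v d)
    have "free_act (Poly_Mapping.single w c * Poly_Mapping.single v d) x
        = free_act (Poly_Mapping.single w c) (free_act (Poly_Mapping.single v d) x)"
      by (simp add: mult_single free_act_single plus_list_def foldr_scale)
    with update show ?case
      by (simp add: update_eq_add_single distrib_left free_act_add free_act_add_right)
  qed
  with update show ?case
    by (simp add: update_eq_add_single distrib_right free_act_add)
qed

lemma free_act_ideal: "p \<in> grass_ideal \<Longrightarrow> free_act p x = 0"
  \<comment> \<open>The vector must vary: a product \<open>p * r\<close> acts on \<open>x\<close> as
    \<open>p\<close> acts on the image of \<open>x\<close> under \<open>r\<close>.\<close>
  by (induction arbitrary: x rule: grass_ideal.induct)
    (simp_all add: free_act_mult free_act_add free_act_single Y_square Y_anticomm
      free_act_zero free_act_zero_right)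

lemma act_abs: "act (abs_grassmann p) x = free_act p x"
proof -
  have "grass_rel (rep_grassmann (abs_grassmann p :: ('k, 'n) grassmann)) p"
    using Quotient3_rep_abs[OF Quotient3_grassmann, of p]
    by (simp add: grass_rel_def grass_ideal.zero)
  then have "rep_grassmann (abs_grassmann p :: ('k, 'n) grassmann) - p \<in> grass_ideal"
    by (simp add: grass_rel_def)
  from free_act_ideal[OF this, of x]
    free_act_add[of "rep_grassmann (abs_grassmann p :: ('k, 'n) grassmann) - p" p x]
  show ?thesis by (simp add: act_def)
qed

lemma act_gen: "act (grass_gen i) x = Y i x"
  by (simp add: grass_gen.abs_eq act_abs free_act_single)

lemma act_one: "act 1 x = x"
  using free_act_single[of 0 1 x]
  by (simp add: one_grassmann.abs_eq act_abs) (simp add: zero_list_def)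

lemma act_add: "act (a + b) x = act a x + act b x"
  by (induction a rule: grassmann.abs_induct, induction b rule: grassmann.abs_induct)
    (simp add: plus_grassmann.abs_eq act_abs free_act_add)

lemma act_mult: "act (a * b) x = act a (act b x)"
  by (induction a rule: grassmann.abs_induct, induction b rule: grassmann.abs_induct)
    (simp add: times_grassmann.abs_eq act_abs free_act_mult)

lemma act_scale: "act (grass_scale c a) x = scl c (act a x)"
  by (induction a rule: grassmann.abs_induct)
    (simp add: grass_scale.abs_eq act_abs free_act_mult free_act_single zero_list_def)

lemma act_scale_right: "act a (scl c x) = scl c (act a x)"
  by (simp add: act_def free_act_scale_right)

end

section \<open>Monomials, induction over the algebra, and algebra homomorphisms\<close>

lemma grass_mono_simps [simp]:
  "grass_mono [] = 1" "grass_mono (i # w) = grass_gen i * grass_mono w"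
  by (simp_all add: grass_mono_def)

lemma abs_single:
  "abs_grassmann (Poly_Mapping.single w c) = grass_scale c (grass_mono w)"
proof (induction w)
  case Nil
  show ?case
    by (simp add: one_grassmann.abs_eq grass_scale.abs_eq zero_list_def)
next
  case (Cons i w)
  have "Poly_Mapping.single (i # w) c = free_gen i * Poly_Mapping.single w c"
    by (simp add: mult_single plus_list_def)
  then have "abs_grassmann (Poly_Mapping.single (i # w) c)
      = grass_gen i * abs_grassmann (Poly_Mapping.single w c)"
    by (simp add: grass_gen.abs_eq times_grassmann.abs_eq)
  with Cons show ?case by (simp add: grass_scale_mult)
qed

lemma span_grass_mono: "a \<in> grass.span (range grass_mono)"
proof (induction a rule: grassmann.abs_induct)
  case (1 p)
  show ?case
  proof (induction p rule: update_induct)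
    case const
    show ?case using grass.span_zero by (simp add: zero_grassmann.abs_eq)
  next
    case (update p w c)
    from update(1) have "abs_grassmann (Poly_Mapping.update w c p)
        = abs_grassmann p + grass_scale c (grass_mono w)"
      by (simp add: update_eq_add_single abs_single flip: plus_grassmann.abs_eq)
    with update.IH show ?case
      by (simp add: grass.span_add grass.span_scale grass.span_base)
  qed
qed

text \<open>Monomials span, and each arises from \<open>1\<close> by left multiplication with
  generators, so closure of \<open>P\<close> under general products need not be checked.\<close>

lemma grass_induct [case_names zero add scale one gen]:
  assumes "P 0"
    and add: "\<And>a b. P a \<Longrightarrow> P b \<Longrightarrow> P (a + b)"
    and scale: "\<And>c a. P a \<Longrightarrow> P (grass_scale c a)"
    and one: "P 1"
    and gen: "\<And>i a. P a \<Longrightarrow> P (grass_gen i * a)"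
  shows "P a"
  using span_grass_mono
proof (induction a rule: grass.span_induct)
  case base
  show ?case using assms by (simp add: grass.subspace_def)
next
  case (step x)
  have "P (grass_mono w)" for w
    by (induction w) (simp_all add: one gen)
  with step show ?case by auto
qed

text \<open>Bijectivity is left out because homomorphisms are first built from values on the
  generators and only later shown to be invertible.\<close>

definition grass_hom :: "('k::comm_ring_1, 'n) grass_endo \<Rightarrow> bool"
  where "grass_hom \<sigma> \<longleftrightarrow> module_hom grass_scale grass_scale \<sigma> \<and> \<sigma> 1 = 1
    \<and> (\<forall>a b. \<sigma> (a * b) = \<sigma> a * \<sigma> b)"

lemma grass_homD:
  assumes "grass_hom \<sigma>"
  shows "\<sigma> (a + b) = \<sigma> a + \<sigma> b" "\<sigma> (grass_scale c a) = grass_scale c (\<sigma> a)" "\<sigma> 1 = 1"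
    "\<sigma> (a * b) = \<sigma> a * \<sigma> b" "\<sigma> 0 = 0" "\<sigma> (- a) = - \<sigma> a" "\<sigma> (a - b) = \<sigma> a - \<sigma> b"
    "\<sigma> (sum f I) = (\<Sum>i\<in>I. \<sigma> (f i))"
proof -
  interpret module_hom grass_scale grass_scale \<sigma> using assms by (simp add: grass_hom_def)
  show "\<sigma> (a + b) = \<sigma> a + \<sigma> b" "\<sigma> (grass_scale c a) = grass_scale c (\<sigma> a)" "\<sigma> 1 = 1"
    "\<sigma> (a * b) = \<sigma> a * \<sigma> b" "\<sigma> 0 = 0" "\<sigma> (- a) = - \<sigma> a" "\<sigma> (a - b) = \<sigma> a - \<sigma> b"
    "\<sigma> (sum f I) = (\<Sum>i\<in>I. \<sigma> (f i))"
    using assms by (simp_all add: grass_hom_def add scale neg diff sum)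
qed

lemma grass_hom_comp: "grass_hom \<sigma> \<Longrightarrow> grass_hom \<tau> \<Longrightarrow> grass_hom (\<sigma> \<circ> \<tau>)"
  by (auto simp: grass_hom_def module_hom_iff)

lemma grass_hom_id: "grass_hom id"
  by (simp add: grass_hom_def grass.module_hom_id)

lemma Aut_iff: "\<sigma> \<in> carrier grass_Aut \<longleftrightarrow> bij \<sigma> \<and> grass_hom \<sigma>"
  by (simp add: grass_hom_def carrier_grass_Aut)

lemma grass_hom_eqI:
  assumes "grass_hom \<sigma>" "grass_hom \<tau>" "\<And>i. \<sigma> (grass_gen i) = \<tau> (grass_gen i)"
  shows "\<sigma> = \<tau>"
proof
  show "\<sigma> a = \<tau> a" for a
    by (induction a rule: grass_induct) (simp_all add: grass_homD[OF assms(1)] grass_homD[OF assms(2)] assms(3))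
qed

text \<open>Left multiplications by the \<open>y i\<close> make the algebra a module over itself in
  a new way; the homomorphism is the orbit map of \<open>1\<close>.\<close>

lemma grass_hom_exists:
  fixes y :: "'n \<Rightarrow> ('k::comm_ring_1, 'n) grassmann"
  assumes "\<And>i. y i * y i = 0" "\<And>i j. i \<noteq> j \<Longrightarrow> y i * y j + y j * y i = 0"
  obtains \<sigma> where "grass_hom \<sigma>" "\<And>i. \<sigma> (grass_gen i) = y i"
proof -
  interpret M: grass_module grass_scale "\<lambda>i x. y i * x"
    by unfold_locales
      (simp_all add: distrib_left grass_scale_mult assms flip: mult.assoc distrib_right)
  \<comment> \<open>The new action commutes with right multiplication, which makes the orbit map of
    \<open>1\<close> multiplicative.\<close>
  have mult: "M.act a x = M.act a 1 * x" for a x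
    by (induction a rule: grass_induct)
      (simp_all add: M.act_add M.act_scale M.act_one M.act_mult M.act_gen
        distrib_right grass_scale_mult mult.assoc,
       metis M.act_add add_cancel_right_left mult_zero_left)
  show thesis
  proof
    show "grass_hom (\<lambda>a. M.act a 1)"
      by (auto simp: grass_hom_def module_hom_iff grass.module_axioms M.act_add M.act_scale M.act_one
          M.act_mult mult[of _ "M.act _ 1"])
    show "M.act (grass_gen i) 1 = y i" for i by (simp add: M.act_gen)
  qed
qed

section \<open>The parity automorphism\<close>

lemma grass_gen_anticomm': "grass_gen i * grass_gen j = - (grass_gen j * grass_gen i)"
  using grass_gen_anticomm[of i j] by (cases "i = j") (auto simp: grass_gen_square)

lemma parity_exists:
  "\<exists>\<sigma> :: ('k::comm_ring_1, 'n) grass_endo. grass_hom \<sigma> \<and> (\<forall>i. \<sigma> (grass_gen i) = - grass_gen i)"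
proof (rule grass_hom_exists[of "\<lambda>i. - grass_gen i"])
  show "- grass_gen i * - grass_gen j + - grass_gen j * - grass_gen i = (0 :: ('k, 'n) grassmann)"
    if "i \<noteq> j" for i j
    by (simp add: grass_gen_anticomm[OF that])
qed (auto simp: grass_gen_square)

text \<open>The grading involution. It replaces membership in the even and odd spans by the
  equations \<open>parity a = a\<close> and \<open>parity a = - a\<close>.\<close>

definition parity :: "('k::comm_ring_1, 'n) grass_endo"
  where "parity = (SOME \<sigma>. grass_hom \<sigma> \<and> (\<forall>i. \<sigma> (grass_gen i) = - grass_gen i))"

lemma parity_hom: "grass_hom parity"
  using someI_ex[OF parity_exists] unfolding parity_def by (rule conjunct1)

lemma parity_gen [simp]: "parity (grass_gen i) = - grass_gen i"
  unfolding parity_def by (rule someI_ex[OF parity_exists, THEN conjunct2, THEN spec])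

lemmas parity_simps [simp] = grass_homD[OF parity_hom]

lemma parity_parity [simp]: "parity (parity a) = a"
  by (induction a rule: grass_induct) simp_all

lemma parity_mono: "parity (grass_mono w) = grass_scale ((- 1) ^ length w) (grass_mono w)"
  by (induction w) (simp_all add: grass_scale_mult)

text \<open>Moving a generator past a word costs one sign per letter, which is what
  \<open>parity\<close> records.\<close>

lemma gen_mult_eq: "grass_gen i * a = parity a * grass_gen i"
proof (induction a rule: grass_induct)
  case (gen j a)
  have "grass_gen i * (grass_gen j * a) = - (grass_gen j * (grass_gen i * a))"
    by (simp only: grass_gen_anticomm'[of i j] mult_minus_left flip: mult.assoc)
  then show ?case by (simp add: gen mult.assoc)
qed (simp_all add: distrib_left distrib_right grass_scale_mult)

text \<open>By \<open>gen_mult_eq\<close> such an \<open>e\<close> commutes with every generator,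
  hence with everything.\<close>

lemma parity_even_central:
  assumes "parity e = e"
  shows "e * a = a * e"
proof (induction a rule: grass_induct)
  case (gen i a)
  have "e * grass_gen i = grass_gen i * e" using gen_mult_eq[of i e] assms by simp
  then have "e * (grass_gen i * a) = grass_gen i * (e * a)" by (simp flip: mult.assoc)
  with gen show ?case by (simp add: mult.assoc)
qed (simp_all add: distrib_left distrib_right grass_scale_mult)

lemma parity_odd_mult:
  assumes "parity u = - u"
  shows "a * u = u * parity a"
proof (induction a rule: grass_induct)
  case (gen i a)
  have "grass_gen i * u = - (u * grass_gen i)"
    unfolding gen_mult_eq[of i u] assms by (rule minus_mult_left[symmetric])
  then have "grass_gen i * (u * parity a) = - (u * (grass_gen i * parity a))"
    by (simp flip: mult.assoc)
  with gen show ?case by (simp add: mult.assoc)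
qed (simp_all add: distrib_left distrib_right grass_scale_mult)

section \<open>Even and odd parts when two is invertible\<close>

locale half_ring =
  fixes h :: "'k::comm_ring_1"
  assumes half: "2 * h = 1"
begin

lemma scale_half_double: "grass_scale h (a + a) = a"
proof -
  have "h + h = 1" using half unfolding mult_2 .
  then show ?thesis
    using grass.scale_left_distrib[of h h a] by (simp add: grass.scale_right_distrib)
qed

lemma double_eq_0: "(a :: ('k, 'n) grassmann) + a = 0 \<Longrightarrow> a = 0"
  using scale_half_double[of a] by simp

text \<open>For the converse, \<open>b + parity b\<close> doubles the monomials of even length and
  kills the others; half of it is \<open>b\<close> itself when \<open>b\<close> is fixed by
  \<open>parity\<close>.\<close>

lemma grass_ev_iff: "(a :: ('k, 'n) grassmann) \<in> grass_ev \<longleftrightarrow> parity a = a"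
proof
  assume "a \<in> grass_ev"
  moreover have "parity b = b" if "b \<in> grass_comp d" "even d" for b :: "('k, 'n) grassmann" and d
    using that(1) unfolding grass_comp_def
    by (induction b rule: grass.span_induct) (use that(2) in \<open>auto simp: grass.subspace_def parity_mono\<close>)
  ultimately show "parity a = a" unfolding grass_ev_def
    by (induction a rule: grass.span_induct) (auto simp: grass.subspace_def)
next
  assume a: "parity a = a"
  have "b + parity b \<in> grass_ev" for b :: "('k, 'n) grassmann"
    using span_grass_mono[of b]
  proof (induction b rule: grass.span_induct)
    case base
    have eq: "x + y + (parity x + parity y) = (x + parity x) + (y + parity y)"
      for x y :: "('k, 'n) grassmann"
      by (simp add: algebra_simps)
    then show ?case
      by (auto simp: eq grass.subspace_def grass_ev_def grass.span_zero grass.span_add grass.span_scale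
          simp flip: grass.scale_right_distrib)
  next
    case (step x)
    then obtain w where x: "x = grass_mono w" by auto
    show ?case
    proof (cases "even (length w)")
      case True
      then have "x \<in> grass_ev" unfolding x grass_ev_def grass_comp_def
        by (intro grass.span_base UN_I[of "length w"]) auto
      with True show ?thesis by (simp add: x parity_mono grass_ev_def grass.span_add)
    qed (simp add: x parity_mono grass_ev_def grass.span_zero)
  qed
  then have "grass_scale h (a + parity a) \<in> grass_ev"
    by (simp only: grass_ev_def grass.span_scale)
  then show "a \<in> grass_ev" by (simp only: a scale_half_double)
qed

text \<open>Dual to \<open>grass_ev_iff\<close>: here \<open>b - parity b\<close> keeps only the
  monomials of odd length, doubled.\<close>

lemma grass_od_iff: "(a :: ('k, 'n) grassmann) \<in> grass_od \<longleftrightarrow> parity a = - a"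
proof
  assume "a \<in> grass_od"
  moreover have "parity b = - b" if "b \<in> grass_comp d" "odd d" for b :: "('k, 'n) grassmann" and d
    using that(1) unfolding grass_comp_def
    by (induction b rule: grass.span_induct) (use that(2) in \<open>auto simp: grass.subspace_def parity_mono\<close>)
  ultimately show "parity a = - a" unfolding grass_od_def
    by (induction a rule: grass.span_induct) (auto simp: grass.subspace_def)
next
  assume a: "parity a = - a"
  have "b - parity b \<in> grass_od" for b :: "('k, 'n) grassmann"
    using span_grass_mono[of b]
  proof (induction b rule: grass.span_induct)
    case base
    have eq: "x + y - (parity x + parity y) = (x - parity x) + (y - parity y)"
      for x y :: "('k, 'n) grassmann"
      by (simp add: algebra_simps)
    then show ?case
      by (auto simp: eq grass.subspace_def grass_od_def grass.span_zero grass.span_add grass.span_scale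
          simp flip: grass.scale_right_diff_distrib)
  next
    case (step x)
    then obtain w where x: "x = grass_mono w" by auto
    show ?case
    proof (cases "odd (length w)")
      case True
      then have "x \<in> grass_od" unfolding x grass_od_def grass_comp_def
        by (intro grass.span_base UN_I[of "length w"]) auto
      with True show ?thesis by (simp add: x parity_mono grass_od_def grass.span_add)
    qed (simp add: x parity_mono grass_od_def grass.span_zero)
  qed
  then have "grass_scale h (a - parity a) \<in> grass_od"
    by (simp only: grass_od_def grass.span_scale)
  then show "a \<in> grass_od" by (simp only: a diff_minus_eq_add scale_half_double)
qed

lemma parity_decomp:
  fixes a :: "('k, 'n) grassmann"
  obtains e u where "a = e + u" "parity e = e" "parity u = - u"
proof
  have "(a + parity a) + (a - parity a) = a + a" by simp
  then show "a = grass_scale h (a + parity a) + grass_scale h (a - parity a)"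
    by (metis grass.scale_right_distrib scale_half_double)
  show "parity (grass_scale h (a + parity a)) = grass_scale h (a + parity a)"
    by (simp add: add.commute)
  show "parity (grass_scale h (a - parity a)) = - grass_scale h (a - parity a)"
    by (metis grass.scale_minus_right minus_diff_eq parity_parity parity_simps(2,7))
qed

text \<open>Applying \<open>parity\<close> turns the sums into differences; adding both equations
  leaves twice the even parts.\<close>

lemma parity_unique:
  fixes e u :: "('k, 'n) grassmann"
  assumes "e + u = e' + u'" "parity e = e" "parity u = - u" "parity e' = e'" "parity u' = - u'"
  shows "e = e'" "u = u'"
proof -
  have "parity (e + u) = parity (e' + u')" using assms(1) by (rule arg_cong)
  then have "e - u = e' - u'" using assms(2-) by simp
  with assms(1) have "(e + u) + (e - u) - ((e' + u') + (e' - u')) = 0" by simp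
  then have "(e - e') + (e - e') = 0" by (simp add: algebra_simps)
  then show "e = e'" using double_eq_0 by fastforce
  with assms(1) show "u = u'" by simp
qed

lemma parity_odd_anticomm:
  fixes u v :: "('k, 'n) grassmann"
  assumes "parity u = - u" "parity v = - v"
  shows "u * v = - (v * u)"
  unfolding parity_odd_mult[OF assms(2), of u] assms(1) by (rule mult_minus_right)

text \<open>Anticommuting with itself gives \<open>u * u + u * u = 0\<close>, and two is
  invertible.\<close>

lemma parity_odd_square:
  fixes u :: "('k, 'n) grassmann"
  assumes "parity u = - u"
  shows "u * u = 0"
  by (rule double_eq_0) (rule eq_neg_iff_add_eq_0[THEN iffD1], rule parity_odd_anticomm[OF assms assms])

end

section \<open>Augmentation and skew derivations\<close>

text \<open>The augmentation, or constant term: all generators act by zero on the ground ring, so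
  only the empty word contributes.\<close>

definition counit :: "('k::comm_ring_1, 'n) grassmann \<Rightarrow> 'k"
  where "counit a = grass_module.act (*) (\<lambda>_ _. 0) a 1"

context
begin

interpretation triv: grass_module "(*) :: 'k \<Rightarrow> 'k \<Rightarrow> 'k::comm_ring_1" "\<lambda>(_ :: 'n) _. 0"
  by unfold_locales (simp_all add: algebra_simps)

lemma counit_simps [simp]:
  "counit (a + b) = counit a + counit b" "counit (grass_scale c a) = c * counit a"
  "counit 1 = 1" "counit (grass_gen i) = 0"
  by (simp_all add: counit_def triv.act_add triv.act_scale triv.act_one triv.act_gen)

lemma counit_mult [simp]: "counit (a * b) = counit a * counit b"
  using triv.act_scale_right[of a "counit b" 1]
  by (simp add: counit_def triv.act_mult mult.commute)

end

lemma counit_additive [simp]: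
  fixes a b :: "('k::comm_ring_1, 'n) grassmann"
  shows "counit (0 :: ('k, 'n) grassmann) = 0" "counit (- a) = - counit a" "counit (a - b) = counit a - counit b"
proof -
  show 0: "counit (0 :: ('k, 'n) grassmann) = 0"
    using counit_simps(1)[of "0 :: ('k, 'n) grassmann" 0] by simp
  show neg: "counit (- a) = - counit a" for a :: "('k, 'n) grassmann"
    using counit_simps(1)[of a "- a"] 0 by (simp add: eq_neg_iff_add_eq_0 add.commute)
  show "counit (a - b) = counit a - counit b"
    using counit_simps(1)[of a "- b"] by (simp add: neg)
qed

lemma counit_parity [simp]: "counit (parity a) = counit a"
  by (induction a rule: grass_induct) simp_all

section \<open>Skew derivations as a component of a module action\<close>

definition pair_scale ::
    "'k::comm_ring_1 \<Rightarrow> ('k, 'n) grassmann \<times> ('k, 'n) grassmann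
      \<Rightarrow> ('k, 'n) grassmann \<times> ('k, 'n) grassmann"
  where "pair_scale c p = (grass_scale c (fst p), grass_scale c (snd p))"

text \<open>
  Left multiplication by a generator, twisted by the derivation: the first component of the
  image of \<open>(0, 1)\<close> under the resulting action obeys the skew Leibniz rule.
\<close>

definition pair_gen ::
    "'n \<Rightarrow> 'n \<Rightarrow> ('k::comm_ring_1, 'n) grassmann \<times> ('k, 'n) grassmann
      \<Rightarrow> ('k, 'n) grassmann \<times> ('k, 'n) grassmann"
  where "pair_gen k i p =
    ((if i = k then snd p else 0) - grass_gen i * fst p, grass_gen i * snd p)"

lemma pair_projections:
  "fst (pair_scale c p) = grass_scale c (fst p)" "snd (pair_scale c p) = grass_scale c (snd p)"
  "fst (pair_gen k i p) = (if i = k then snd p else 0) - grass_gen i * fst p"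
  "snd (pair_gen k i p) = grass_gen i * snd p"
  by (simp_all add: pair_scale_def pair_gen_def)

lemma gen_gen_mult: "grass_gen i * (grass_gen i * a) = 0"
  by (simp add: grass_gen_square flip: mult.assoc)

lemma gen_swap_mult: "grass_gen i * (grass_gen j * a) = - (grass_gen j * (grass_gen i * a))"
  by (simp only: grass_gen_anticomm'[of i j] mult_minus_left flip: mult.assoc)

text \<open>The minus sign in the first component makes the terms contributed by the index
  \<open>k\<close> cancel in pairs; the rest is the Grassmann relation itself.\<close>

lemma grass_module_pair:
  fixes k :: 'n
  shows "grass_module (pair_scale :: 'k::comm_ring_1 \<Rightarrow> ('k, 'n) grassmann \<times> _ \<Rightarrow> _) (pair_gen k)"
proof unfold_locales
  fix i j :: 'n and x :: "('k, 'n) grassmann \<times> ('k, 'n) grassmann"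
  show "pair_gen k i (pair_gen k i x) = 0"
    by (simp add: pair_gen_def right_diff_distrib gen_gen_mult zero_prod_def)
  assume "i \<noteq> j"
  then show "pair_gen k i (pair_gen k j x) + pair_gen k j (pair_gen k i x) = 0"
    by (simp add: pair_gen_def right_diff_distrib zero_prod_def gen_swap_mult[of i j])
qed (auto simp: pair_gen_def pair_scale_def algebra_simps grass_scale_mult
    grass.scale_right_diff_distrib grass.scale_right_distrib grass.scale_left_distrib)

definition deriv :: "'n \<Rightarrow> ('k::comm_ring_1, 'n) grassmann \<Rightarrow> ('k, 'n) grassmann"
  where "deriv k a = fst (grass_module.act pair_scale (pair_gen k) a (0, 1))"

text \<open>The second component carries the element itself, which supplies the term
  \<open>a\<close> in the Leibniz rule \<open>deriv_gen\<close>.\<close>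

lemma snd_pair_act:
  fixes a :: "('k::comm_ring_1, 'n) grassmann"
  shows "snd (grass_module.act pair_scale (pair_gen k) a (0, 1)) = a"
proof -
  interpret pair: grass_module "pair_scale :: 'k \<Rightarrow> ('k, 'n) grassmann \<times> _ \<Rightarrow> _" "pair_gen k" by (rule grass_module_pair)
  show ?thesis
  proof (induction a rule: grass_induct)
    case zero
    have "pair.act 0 (0, 1) = 0" using pair.act_add[of 0 0 "(0, 1)"] by simp
    then show ?case by (simp only: snd_zero)
  qed (simp_all add: pair.act_add pair.act_scale pair.act_one pair.act_mult
      pair.act_gen pair_projections)
qed

lemma deriv_simps [simp]:
  fixes a :: "('k::comm_ring_1, 'n) grassmann"
  shows "deriv k (a + b) = deriv k a + deriv k b" "deriv k (grass_scale c a) = grass_scale c (deriv k a)"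
  "deriv k (1 :: ('k, 'n) grassmann) = 0"
  and deriv_gen: "deriv k (grass_gen i * a) = (if i = k then a else 0) - grass_gen i * deriv k a"
proof -
  interpret pair: grass_module "pair_scale :: 'k \<Rightarrow> ('k, 'n) grassmann \<times> _ \<Rightarrow> _" "pair_gen k" by (rule grass_module_pair)
  show "deriv k (a + b) = deriv k a + deriv k b" "deriv k (grass_scale c a) = grass_scale c (deriv k a)"
    "deriv k (1 :: ('k, 'n) grassmann) = 0"
    "deriv k (grass_gen i * a) = (if i = k then a else 0) - grass_gen i * deriv k a"
    by (simp_all add: deriv_def pair.act_add pair.act_scale pair.act_one pair.act_mult
        pair.act_gen pair_projections snd_pair_act)
qed

lemma deriv_zero [simp]: "deriv k 0 = 0"
  using deriv_simps(1)[of k 0 0] by simp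

text \<open>
  Acyclicity of the Koszul complex in the one degree needed; \<^term>\<open>deriv k\<close> is a contracting
  homotopy for multiplication by the \<open>k\<close>-th generator.
\<close>

lemma gen_mult_system:
  fixes f :: "'n \<Rightarrow> ('k::comm_ring_1, 'n) grassmann"
  assumes "finite I"
    and "\<And>i. i \<in> I \<Longrightarrow> grass_gen i * f i = 0"
    and "\<And>i j. i \<in> I \<Longrightarrow> j \<in> I \<Longrightarrow> grass_gen i * f j = - (grass_gen j * f i)"
  obtains b where "\<And>i. i \<in> I \<Longrightarrow> f i = grass_gen i * b"
  using assms
proof (induction I arbitrary: thesis rule: finite_induct)
  case empty
  show ?case by (rule empty.prems(1)) simp
next
  case (insert k I)
  from insert.IH obtain b where b: "\<And>i. i \<in> I \<Longrightarrow> f i = grass_gen i * b"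
    using insert.prems(2,3) by blast
  define g where "g = f k - grass_gen k * b"
  have gk: "grass_gen k * g = 0"
    using insert.prems(2)[of k] by (simp add: g_def right_diff_distrib gen_gen_mult)
  \<comment> \<open>The defect \<open>g\<close> of the old solution \<open>b\<close> at the new
    index is killed by the old generators, because the system is antisymmetric.\<close>
  have gi: "grass_gen i * g = 0" if "i \<in> I" for i
    using insert.prems(3)[of i k] b[OF that] that
    by (simp add: g_def right_diff_distrib gen_swap_mult[of i k])
  \<comment> \<open>Differentiating \<open>grass_gen k * g = 0\<close> exhibits the defect as a
    multiple of the new generator.\<close>
  have gk': "g = grass_gen k * deriv k g"
    using deriv_gen[of k k g] gk by simp
  \<comment> \<open>Adding \<open>deriv k g\<close> to \<open>b\<close> therefore leaves the old
    equations intact.\<close>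
  have gi': "grass_gen i * deriv k g = 0" if "i \<in> I" for i
    using deriv_gen[of k i g] gi[OF that] insert.hyps(2) that by (cases "i = k") auto
  have "f k = grass_gen k * b + g" by (simp add: g_def)
  also have "\<dots> = grass_gen k * (b + deriv k g)" unfolding distrib_left using gk' by (rule arg_cong)
  finally have "f i = grass_gen i * (b + deriv k g)" if "i \<in> insert k I" for i
    using that b gi' by (auto simp: distrib_left)
  then show ?case by (rule insert.prems(1))
qed

section \<open>Linear parts\<close>

text \<open>The coefficient of the \<open>k\<close>-th generator in degree one.\<close>

definition lin :: "'n \<Rightarrow> ('k::comm_ring_1, 'n) grassmann \<Rightarrow> 'k"
  where "lin k a = counit (deriv k a)"

lemma lin_simps [simp]:
  "lin k (a + b) = lin k a + lin k b" "lin k (grass_scale c a) = c * lin k a"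
  "lin k 1 = 0" "lin k 0 = 0"
  by (simp_all add: lin_def)

lemma lin_gen_mult [simp]: "lin k (grass_gen i * a) = (if i = k then counit a else 0)"
  by (simp add: lin_def deriv_gen)

lemma lin_gen [simp]:
  "lin k (grass_gen i :: ('k::comm_ring_1, 'n) grassmann) = (if i = k then 1 else 0)"
  using lin_gen_mult[of k i "1 :: ('k, 'n) grassmann"] by simp

lemma lin_additive [simp]:
  fixes a b :: "('k::comm_ring_1, 'n) grassmann"
  shows "lin k (- a) = - lin k a" "lin k (a - b) = lin k a - lin k b"
  "lin k (sum f I) = (\<Sum>i\<in>I. lin k (f i))"
proof -
  show neg: "lin k (- a) = - lin k a" for a :: "('k, 'n) grassmann"
    using lin_simps(1)[of k a "- a"] by (simp add: eq_neg_iff_add_eq_0 add.commute)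
  show "lin k (a - b) = lin k a - lin k b"
    using lin_simps(1)[of k a "- b"] by (simp add: neg)
  show "lin k (sum f I) = (\<Sum>i\<in>I. lin k (f i))"
    by (induction I rule: infinite_finite_induct) simp_all
qed

text \<open>At the level of constant terms the sign in the skew Leibniz rule disappears.\<close>

lemma lin_mult: "lin k (a * b) = lin k a * counit b + counit a * lin k b"
proof (induction a rule: grass_induct)
  case (add a a')
  then show ?case by (simp add: distrib_right algebra_simps)
next
  case (scale c a)
  then show ?case by (simp add: grass_scale_mult algebra_simps)
qed (simp_all add: mult.assoc)

lemma lin_parity: "lin k (parity a) = - lin k a"
  by (induction a rule: grass_induct) simp_all

lemma hom_counit:
  assumes "grass_hom \<sigma>" "\<And>i. counit (\<sigma> (grass_gen i)) = 0"
  shows "counit (\<sigma> a) = counit a"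
  by (induction a rule: grass_induct) (simp_all add: grass_homD[OF assms(1)] assms(2))

text \<open>The chain rule at the origin: since images of generators have no constant term, longer
  monomials contribute nothing to the linear part of the image.\<close>

lemma hom_lin:
  fixes \<sigma> :: "('k::comm_ring_1, 'n::finite) grass_endo"
  assumes "grass_hom \<sigma>" "\<And>i. counit (\<sigma> (grass_gen i)) = 0"
  shows "lin k (\<sigma> a) = (\<Sum>i\<in>UNIV. lin i a * lin k (\<sigma> (grass_gen i)))"
proof (induction a rule: grass_induct)
  case (gen j a)
  have "lin k (\<sigma> (grass_gen j * a)) = lin k (\<sigma> (grass_gen j)) * counit a"
    by (simp add: grass_homD(4)[OF assms(1)] lin_mult assms(2) hom_counit[OF assms])
  also have "\<dots> = (\<Sum>i\<in>UNIV. if i = j then lin k (\<sigma> (grass_gen i)) * counit a else 0)"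
    by simp
  also have "\<dots> = (\<Sum>i\<in>UNIV. lin i (grass_gen j * a) * lin k (\<sigma> (grass_gen i)))"
    by (rule sum.cong) (auto simp: mult.commute)
  finally show ?case .
next
  case (add a b)
  then show ?case by (simp add: grass_homD(1)[OF assms(1)] sum.distrib distrib_right)
next
  case (scale c a)
  then show ?case by (simp add: grass_homD(2)[OF assms(1)] sum_distrib_left mult.assoc)
qed (simp_all add: grass_homD(3,5)[OF assms(1)])

section \<open>The augmentation ideal\<close>

lemma grass_mono_append: "grass_mono (v @ w) = grass_mono v * grass_mono w"
  by (induction v) (simp_all add: mult.assoc)

lemma gen_mult_mono_eq_0: "i \<in> set w \<Longrightarrow> grass_gen i * grass_mono w = 0"
proof (induction w)
  case (Cons j w)
  show ?case
  proof (cases "i = j")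
    case False
    with Cons show ?thesis by (simp add: gen_swap_mult[of i j])
  qed (simp add: gen_gen_mult)
qed simp

lemma grass_mono_eq_0: "\<not> distinct w \<Longrightarrow> grass_mono w = 0"
  by (induction w) (auto simp: gen_mult_mono_eq_0)

lemma grass_mono_in_comp: "length w = d \<Longrightarrow> grass_mono w \<in> grass_comp d"
  unfolding grass_comp_def by (rule grass.span_base) auto

lemma grass_max_induct [consumes 1, case_names subspace mono]:
  assumes "a \<in> grass_max" "grass.subspace (Collect P)" "\<And>w. w \<noteq> [] \<Longrightarrow> P (grass_mono w)"
  shows "P a"
  using assms(1) unfolding grass_max_def
proof (induction a rule: grass.span_induct)
  case (step a)
  then obtain d where "d \<ge> 1" "a \<in> grass_comp d" by auto
  from this(2) show ?case unfolding grass_comp_def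
    by (induction a rule: grass.span_induct) (use \<open>d \<ge> 1\<close> assms(2) in \<open>auto intro!: assms(3)\<close>)
qed (rule assms(2))

text \<open>Every nonempty monomial has a generator as first factor and so no constant term;
  conversely, subtracting the constant term removes the empty monomial.\<close>

lemma grass_max_iff: "a \<in> grass_max \<longleftrightarrow> counit a = 0"
proof
  assume "a \<in> grass_max"
  then show "counit a = 0"
  proof (induction rule: grass_max_induct)
    case (mono w)
    then show ?case by (cases w) auto
  qed (auto simp: grass.subspace_def)
next
  have "a - grass_scale (counit a) 1 \<in> grass_max" using span_grass_mono[of a]
  proof (induction a rule: grass.span_induct)
    case base
    have eq: "x + y - grass_scale (c + d) 1 = (x - grass_scale c 1) + (y - grass_scale d 1)"
      for x y :: "('a, 'b) grassmann" and c d
      by (simp add: grass.scale_left_distrib)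
    have eq': "grass_scale c x - grass_scale (c * d) 1 = grass_scale c (x - grass_scale d 1)"
      for x :: "('a, 'b) grassmann" and c d
      by (simp add: grass.scale_right_diff_distrib)
    show ?case
      by (auto simp: grass.subspace_def grass_max_def eq eq' grass.span_zero
          intro: grass.span_add grass.span_scale)
  next
    case (step x)
    then obtain w where w: "x = grass_mono w" by auto
    show ?case
    proof (cases w)
      case Nil
      with w show ?thesis by (simp add: grass_max_def grass.span_zero)
    next
      case (Cons i v)
      have "x \<in> grass_max" unfolding w grass_max_def
        by (intro grass.span_base UN_I[of "length w"] grass_mono_in_comp) (simp_all add: Cons)
      moreover have "counit x = 0" by (simp add: w Cons)
      ultimately show ?thesis by simp
    qed
  qed
  then show "counit a = 0 \<Longrightarrow> a \<in> grass_max" by simp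
qed

lemma counit_zero_nilpotent:
  fixes a :: "('k::comm_ring_1, 'n::finite) grassmann"
  assumes "counit a = 0"
  obtains d where "a ^ d = 0"
proof -
  \<comment> \<open>Multiplication by \<open>a\<close> raises the index of this filtration, which
    vanishes beyond the number of generators because longer words repeat a letter.\<close>
  define F where "F d = grass.span {grass_mono w :: ('k, 'n) grassmann | w. length w \<ge> d}" for d
  have step: "a * b \<in> F (Suc d)" if "b \<in> F d" for b d
  proof -
    have "a \<in> grass_max" by (simp add: grass_max_iff assms)
    then show ?thesis
    proof (induction rule: grass_max_induct)
      case subspace
      show ?case
        by (auto simp: grass.subspace_def F_def grass.span_zero distrib_right grass_scale_mult
          intro: grass.span_add grass.span_scale)
    next
      case (mono w)
      from \<open>b \<in> F d\<close> show ?case unfolding F_def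
      proof (induction b rule: grass.span_induct)
        case base
        show ?case
          by (auto simp: grass.subspace_def F_def grass.span_zero distrib_left grass_scale_mult
            intro: grass.span_add grass.span_scale)
      next
        case (step b)
        then obtain v where "b = grass_mono v" "length v \<ge> d" by auto
        with mono show ?case
          by (auto intro!: grass.span_base exI[of _ "w @ v"] simp: grass_mono_append
            simp flip: length_greater_0_conv)
      qed
    qed
  qed
  have pow: "a ^ d \<in> F d" for d
  proof (induction d)
    case 0
    have "grass_mono [] \<in> F 0" unfolding F_def by (rule grass.span_base) blast
    then show ?case by simp
  next
    case (Suc d)
    then show ?case using step by simp
  qed
  have "grass_mono w = (0 :: ('k, 'n) grassmann)" if "length w \<ge> Suc (CARD('n))" for w :: "'n list"
  proof (rule grass_mono_eq_0)
    show "\<not> distinct w"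
      using that card_mono[of UNIV "set w"] by (auto dest: distinct_card)
  qed
  then have "{grass_mono w :: ('k, 'n) grassmann | w. length w \<ge> Suc (CARD('n))} \<subseteq> {0}" by auto
  then have "F (Suc (CARD('n))) \<subseteq> {0}" unfolding F_def
    using grass.span_minimal[OF _ grass.subspace_single_0] by blast
  then have "a ^ Suc (CARD('n)) = 0" using pow by blast
  then show thesis by (rule that)
qed

text \<open>The geometric series of the nilpotent \<open>p\<close> is finite, and powers of an even
  element are even.\<close>

lemma even_unipotent_inverse:
  fixes p :: "('k::comm_ring_1, 'n::finite) grassmann"
  assumes "counit p = 0" "parity p = p"
  obtains r where "r * (1 - p) = 1" "parity r = r"
proof -
  obtain d where d: "p ^ d = 0" using counit_zero_nilpotent[OF assms(1)] .
  have "(\<Sum>i<m. p ^ i) * (1 - p) = 1 - p ^ m" for m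
  proof (induction m)
    case (Suc m)
    have "(\<Sum>i<Suc m. p ^ i) * (1 - p) = (\<Sum>i<m. p ^ i) * (1 - p) + p ^ m * (1 - p)"
      by (simp only: sum.lessThan_Suc distrib_right)
    also have "\<dots> = (1 - p ^ m) + (p ^ m - p * p ^ m)"
      unfolding Suc by (simp add: right_diff_distrib power_commutes)
    also have "\<dots> = 1 - p ^ Suc m" by simp
    finally show ?case .
  qed simp
  with d have "(\<Sum>i<d. p ^ i) * (1 - p) = 1" by (simp only: diff_zero)
  moreover have pow: "parity (p ^ m) = p ^ m" for m
    by (induction m) (simp_all add: assms(2))
  have "parity (\<Sum>i<d. p ^ i) = (\<Sum>i<d. p ^ i)"
    by (simp add: pow)
  ultimately show thesis by (rule that)
qed

section \<open>Semidirect complements\<close>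

text \<open>The complement meets each coset of \<open>N\<close> exactly once: trivial intersection
  gives injectivity of \<open>x \<mapsto> N #> x\<close>, and the product decomposition gives
  surjectivity.\<close>

lemma (in group) semidirect_quotient_iso:
  assumes "internal_semidirect G N H"
  shows "G Mod N \<cong> G\<lparr>carrier := H\<rparr>"
proof -
  from assms have N: "N \<lhd> G" and H: "subgroup H G" and int: "N \<inter> H = {\<one>}"
    and prod: "N <#> H = carrier G"
    by (simp_all add: internal_semidirect_def)
  interpret N: normal N G by (rule N)
  interpret H: subgroup H G by (rule H)
  have sub: "subgroup N G" by (rule N.subgroup_axioms)
  have "(\<lambda>x. N #> x) \<in> iso (G\<lparr>carrier := H\<rparr>) (G Mod N)"
  proof (rule isoI)
    show "(\<lambda>x. N #> x) \<in> hom (G\<lparr>carrier := H\<rparr>) (G Mod N)"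
      using H.subset by (auto simp: hom_def FactGroup_def RCOSETS_def N.rcos_sum)
    have "inj_on (\<lambda>x. N #> x) H"
    proof (rule inj_onI)
      fix x y assume x: "x \<in> H" and y: "y \<in> H" and eq: "N #> x = N #> y"
      have "x \<in> N #> y" using rcos_self[of x N] x sub by (simp add: eq)
      then obtain n where n: "n \<in> N" "x = n \<otimes> y" by (auto simp: r_coset_def)
      then have "n = x \<otimes> inv y" using y by (simp add: m_assoc)
      then have "n \<in> H" using x y by simp
      then have "n = \<one>" using n int by blast
      then show "x = y" using n y by simp
    qed
    moreover have "(\<lambda>x. N #> x) ` H = rcosets N"
    proof
      show "(\<lambda>x. N #> x) ` H \<subseteq> rcosets N" using H.subset by (auto simp: RCOSETS_def)
      show "rcosets N \<subseteq> (\<lambda>x. N #> x) ` H"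
      proof
        fix C assume "C \<in> rcosets N"
        then obtain g where g: "g \<in> carrier G" "C = N #> g" by (auto simp: RCOSETS_def)
        from g(1) have "g \<in> N <#> H" by (simp add: prod)
        then obtain n x where nx: "n \<in> N" "x \<in> H" "g = n \<otimes> x"
          by (auto simp: set_mult_def)
        then have "C = N #> x"
          using g N.subset N.rcos_const[OF is_group] coset_mult_assoc[of N n x] by simp
        then show "C \<in> (\<lambda>x. N #> x) ` H" using nx by blast
      qed
    qed
    ultimately show "bij_betw (\<lambda>x. N #> x) (carrier (G\<lparr>carrier := H\<rparr>)) (carrier (G Mod N))"
      by (simp add: bij_betw_def FactGroup_def)
  qed
  then have "G\<lparr>carrier := H\<rparr> \<cong> G Mod N" by (rule is_isoI)
  then show ?thesis
    using group.iso_sym[OF H.subgroup_is_group[OF is_group]] by blast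
qed

section \<open>Automorphisms\<close>

lemma Aut_inv:
  fixes \<sigma> :: "('k::comm_ring_1, 'n) grass_endo"
  assumes "\<sigma> \<in> carrier grass_Aut"
  shows "inv\<^bsub>grass_Aut\<^esub> \<sigma> \<in> carrier grass_Aut"
    "\<sigma> ((inv\<^bsub>grass_Aut\<^esub> \<sigma>) a) = a" "(inv\<^bsub>grass_Aut\<^esub> \<sigma>) (\<sigma> a) = a"
proof -
  interpret G: group "grass_Aut :: ('k, 'n) grass_endo monoid" by (rule group_grass_Aut)
  show "inv\<^bsub>grass_Aut\<^esub> \<sigma> \<in> carrier grass_Aut" using assms by (rule G.inv_closed)
  have "\<sigma> \<circ> inv\<^bsub>grass_Aut\<^esub> \<sigma> = id" "inv\<^bsub>grass_Aut\<^esub> \<sigma> \<circ> \<sigma> = id"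
    using G.r_inv[OF assms] G.l_inv[OF assms] by simp_all
  then show "\<sigma> ((inv\<^bsub>grass_Aut\<^esub> \<sigma>) a) = a" "(inv\<^bsub>grass_Aut\<^esub> \<sigma>) (\<sigma> a) = a"
    by (metis comp_apply id_apply)+
qed

text \<open>Encoded as equality with one's own linear part, so that linear forms with equal
  coefficients are equal at once.\<close>

definition linear_forms :: "('k::comm_ring_1, 'n::finite) grassmann set"
  where "linear_forms = {a. a = (\<Sum>j\<in>UNIV. grass_scale (lin j a) (grass_gen j))}"

lemma linear_forms_eqI:
  "a \<in> linear_forms \<Longrightarrow> b \<in> linear_forms \<Longrightarrow> (\<And>k. lin k a = lin k b) \<Longrightarrow> a = b"
  by (simp add: linear_forms_def)

lemma lin_sum_gen:
  "lin k (\<Sum>j\<in>UNIV. grass_scale (c j) (grass_gen j :: ('k::comm_ring_1, 'n::finite) grassmann)) = c k"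
proof -
  have "lin k (\<Sum>j\<in>UNIV. grass_scale (c j) (grass_gen j :: ('k, 'n) grassmann))
      = (\<Sum>j\<in>UNIV. if j = k then c j else 0)"
    unfolding lin_additive by (rule sum.cong) simp_all
  then show ?thesis by simp
qed

lemma sum_gen_linear_form: "(\<Sum>j\<in>UNIV. grass_scale (c j) (grass_gen j)) \<in> linear_forms"
  by (simp only: linear_forms_def mem_Collect_eq lin_sum_gen)

lemma gen_linear_form: "(grass_gen i :: ('k::comm_ring_1, 'n::finite) grassmann) \<in> linear_forms"
proof -
  have "(\<Sum>j\<in>UNIV. grass_scale (if j = i then 1 else 0) (grass_gen j :: ('k, 'n) grassmann))
      = (\<Sum>j\<in>UNIV. if j = i then grass_gen j else 0)"
    by (rule sum.cong) simp_all
  then have "(\<Sum>j\<in>UNIV. grass_scale (if j = i then 1 else 0) (grass_gen j)) = (grass_gen i :: ('k, 'n) grassmann)"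
    by simp
  then show ?thesis by (metis sum_gen_linear_form)
qed

lemma linear_forms_odd: "a \<in> linear_forms \<Longrightarrow> parity a = - a"
proof -
  have "parity (\<Sum>j\<in>UNIV. grass_scale (c j) (grass_gen j))
      = - (\<Sum>j\<in>UNIV. grass_scale (c j) (grass_gen j :: ('k::comm_ring_1, 'n::finite) grassmann))" for c
    by (simp add: sum_negf)
  from this[of "\<lambda>j. lin j a"] show "a \<in> linear_forms \<Longrightarrow> parity a = - a"
    by (simp add: linear_forms_def)
qed

lemma hom_linear_forms:
  assumes "grass_hom \<sigma>" "\<And>i. \<sigma> (grass_gen i) \<in> linear_forms" "a \<in> linear_forms"
  shows "(\<sigma> a :: ('a::comm_ring_1, 'b::finite) grassmann) \<in> linear_forms"
proof -
  have sub: "grass.subspace (linear_forms :: ('a, 'b) grassmann set)"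
  proof (rule grass.subspaceI)
    fix c and x :: "('a, 'b) grassmann" assume "x \<in> linear_forms"
    then have "grass_scale c x = (\<Sum>j\<in>UNIV. grass_scale c (grass_scale (lin j x) (grass_gen j)))"
      unfolding grass.scale_sum_right[symmetric] by (simp add: linear_forms_def)
    then show "grass_scale c x \<in> linear_forms"
      by (simp only: grass.scale_scale sum_gen_linear_form)
  qed (auto simp: linear_forms_def sum.distrib grass.scale_left_distrib)
  have "a = (\<Sum>j\<in>UNIV. grass_scale (lin j a) (grass_gen j))"
    using assms(3) by (simp add: linear_forms_def)
  then have "\<sigma> a = \<sigma> (\<Sum>j\<in>UNIV. grass_scale (lin j a) (grass_gen j))" by (rule arg_cong)
  also have "\<dots> = (\<Sum>j\<in>UNIV. grass_scale (lin j a) (\<sigma> (grass_gen j)))"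
    by (simp add: grass_homD(2,8)[OF assms(1)])
  finally show ?thesis
    by (simp only:) (intro grass.subspace_sum[OF sub] grass.subspace_scale[OF sub] assms(2))
qed

lemma ideal_mult_max_counit: "a \<in> ideal_mult grass_max J \<Longrightarrow> counit a = 0"
  unfolding ideal_mult_def
  by (induction a rule: grass.span_induct) (auto simp: grass.subspace_def grass_max_iff)

lemma max_cube_lin:
  "a \<in> ideal_mult grass_max (ideal_mult grass_max grass_max) \<Longrightarrow> lin k a = 0"
  \<comment> \<open>Only the outer product is unfolded; of the inner one just the vanishing constant
    term is used, and \<open>lin_mult\<close> kills such products.\<close>
  unfolding ideal_mult_def[of _ "ideal_mult _ _"]
  by (induction a rule: grass.span_induct)
    (auto simp: grass.subspace_def grass_max_iff lin_mult ideal_mult_max_counit)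

text \<open>Odd words have one letter or at least three; without a linear part only the latter
  remain.\<close>

lemma grass_od_max_cube:
  fixes a :: "('k::comm_ring_1, 'n::finite) grassmann"
  assumes "a \<in> grass_od" "\<And>k. lin k a = 0"
  shows "a \<in> ideal_mult grass_max (ideal_mult grass_max grass_max)"
proof -
  let ?M = "ideal_mult grass_max (ideal_mult grass_max grass_max) :: ('k, 'n) grassmann set"
  \<comment> \<open>Stripping the linear part by a linear map allows the claim to be checked on
    monomials.\<close>
  define q where "q b = b - (\<Sum>j\<in>UNIV. grass_scale (lin j b) (grass_gen j))"
    for b :: "('k, 'n) grassmann"
  have M: "grass.subspace ?M" unfolding ideal_mult_def by (rule grass.subspace_span)
  have q_add: "q (b + c) = q b + q c" for b c
    by (simp add: q_def grass.scale_left_distrib sum.distrib)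
  have q_scale: "q (grass_scale x b) = grass_scale x (q b)" for x b
    by (simp add: q_def grass.scale_right_diff_distrib grass.scale_sum_right)
  have "q 0 = 0" by (simp add: q_def)
  then have sub: "grass.subspace {b. q b \<in> ?M}"
    using M by (auto simp: grass.subspace_def q_add q_scale)
  have mono: "q (grass_mono w) \<in> ?M" if "odd (length w)" for w
  proof -
    from that obtain i v where w: "w = i # v" by (cases w) auto
    show ?thesis
    proof (cases v)
      case Nil
      have "q (grass_gen i) = 0"
        using gen_linear_form[of i] by (simp only: q_def linear_forms_def mem_Collect_eq) simp
      then show ?thesis using grass.subspace_0[OF M] by (simp add: w Nil)
    next
      case (Cons j v')
      with that w obtain l u where v: "v = j # l # u" by (cases v') auto
      have mult: "b * c \<in> ideal_mult grass_max J" if "counit b = 0" "c \<in> J" for b c and J :: "('k, 'n) grassmann set"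
        unfolding ideal_mult_def by (rule grass.span_base) (use that in \<open>auto simp: grass_max_iff\<close>)
      have "grass_mono w \<in> ?M"
        by (simp add: w v) (intro mult, simp_all add: grass_max_iff)
      moreover have "q (grass_mono w) = grass_mono w" by (simp add: q_def w v cong: if_cong)
      ultimately show ?thesis by simp
    qed
  qed
  have "q a \<in> ?M" using assms(1) unfolding grass_od_def
  proof (induction a rule: grass.span_induct)
    case (step a)
    then obtain d where "odd d" "a \<in> grass_comp d" by auto
    from this(2) show ?case unfolding grass_comp_def
      by (induction a rule: grass.span_induct) (use \<open>odd d\<close> sub mono in auto)
  qed (use sub in simp)
  then show ?thesis by (simp add: q_def assms(2))
qed

section \<open>Consequences of reducedness and graded automorphisms\<close>

locale reduced_half_ring = half_ring h for h :: "'k::comm_ring_1" +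
  assumes reduced: "(c::'k) ^ m = 0 \<Longrightarrow> c = 0"
begin

text \<open>The image of a generator squares to zero, hence so does its constant term in the reduced
  ring.\<close>

lemma hom_counit_gen:
  fixes \<sigma> :: "('k, 'n) grass_endo"
  assumes "grass_hom \<sigma>"
  shows "counit (\<sigma> (grass_gen i)) = 0"
proof (rule reduced)
  have "\<sigma> (grass_gen i * grass_gen i) = 0"
    by (simp only: grass_gen_square grass_homD(5)[OF assms])
  then have "counit (\<sigma> (grass_gen i) * \<sigma> (grass_gen i)) = 0"
    by (simp only: grass_homD(4)[OF assms] counit_additive)
  then show "counit (\<sigma> (grass_gen i)) ^ 2 = 0" by (simp add: power2_eq_square)
qed

lemma hom_lin':
  fixes \<sigma> :: "('k, 'n::finite) grass_endo"
  assumes "grass_hom \<sigma>"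
  shows "lin k (\<sigma> a) = (\<Sum>i\<in>UNIV. lin i a * lin k (\<sigma> (grass_gen i)))"
  by (rule hom_lin[OF assms hom_counit_gen[OF assms]])

text \<open>The even and odd parts are the eigenspaces of \<open>parity\<close>. Forward, odd images
  of the generators already force commutation; backward, bijectivity upgrades inclusions to
  equalities of images.\<close>

lemma Z2gr_iff:
  fixes \<sigma> :: "('k, 'n) grass_endo"
  shows "\<sigma> \<in> grass_Z2gr \<longleftrightarrow> \<sigma> \<in> carrier grass_Aut \<and> (\<forall>a. parity (\<sigma> a) = \<sigma> (parity a))"
proof safe
  assume \<sigma>: "\<sigma> \<in> grass_Z2gr"
  then show A: "\<sigma> \<in> carrier grass_Aut" by (simp add: grass_Z2gr_def)
  then have hom: "grass_hom \<sigma>" by (simp add: Aut_iff)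
  have "parity \<circ> \<sigma> = \<sigma> \<circ> parity"
  proof (rule grass_hom_eqI)
    fix i
    have "grass_gen i \<in> (grass_od :: ('k, 'n) grassmann set)" by (simp add: grass_od_iff)
    then have "\<sigma> (grass_gen i) \<in> grass_od" using \<sigma> by (auto simp: grass_Z2gr_def)
    then show "(parity \<circ> \<sigma>) (grass_gen i) = (\<sigma> \<circ> parity) (grass_gen i)"
      by (simp add: grass_od_iff grass_homD(6)[OF hom])
  qed (simp_all add: grass_hom_comp hom parity_hom)
  then show "parity (\<sigma> a) = \<sigma> (parity a)" for a by (simp add: fun_eq_iff)
next
  assume A: "\<sigma> \<in> carrier grass_Aut" and comm: "\<forall>a. parity (\<sigma> a) = \<sigma> (parity a)"
  then have hom: "grass_hom \<sigma>" and bij: "bij \<sigma>" by (simp_all add: Aut_iff)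
  have inj: "\<sigma> a = \<sigma> b \<longleftrightarrow> a = b" for a b using bij by (simp add: bij_is_inj inj_eq)
  have "\<sigma> a \<in> grass_ev \<longleftrightarrow> a \<in> grass_ev" for a by (simp add: grass_ev_iff comm inj)
  moreover have "\<sigma> a \<in> grass_od \<longleftrightarrow> a \<in> grass_od" for a
    by (simp add: grass_od_iff comm inj flip: grass_homD(6)[OF hom])
  moreover have "\<exists>a. b = \<sigma> a" for b using bij by (metis bij_pointE)
  ultimately show "\<sigma> \<in> grass_Z2gr" using A by (fastforce simp: grass_Z2gr_def)
qed

lemma Z2gr_genI:
  fixes \<sigma> :: "('k, 'n) grass_endo"
  assumes "\<sigma> \<in> carrier grass_Aut" "\<And>i. parity (\<sigma> (grass_gen i)) = - \<sigma> (grass_gen i)"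
  shows "\<sigma> \<in> grass_Z2gr"
proof -
  have hom: "grass_hom \<sigma>" using assms by (simp add: Aut_iff)
  have "parity \<circ> \<sigma> = \<sigma> \<circ> parity"
    by (rule grass_hom_eqI)
      (simp_all add: grass_hom_comp hom parity_hom assms(2) grass_homD(6)[OF hom])
  then show ?thesis using assms(1) by (simp add: Z2gr_iff fun_eq_iff)
qed

lemma subgroup_Z2gr: "subgroup (grass_Z2gr :: ('k, 'n) grass_endo set) grass_Aut"
proof (rule group.subgroupI[OF group_grass_Aut])
  show "(grass_Z2gr :: ('k, 'n) grass_endo set) \<subseteq> carrier grass_Aut" by (auto simp: Z2gr_iff)
  have "id \<in> (grass_Z2gr :: ('k, 'n) grass_endo set)"
    by (simp add: Z2gr_iff Aut_iff grass_hom_id)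
  then show "(grass_Z2gr :: ('k, 'n) grass_endo set) \<noteq> {}" by blast
next
  fix \<sigma> :: "('k, 'n) grass_endo" assume \<sigma>: "\<sigma> \<in> grass_Z2gr"
  then have A: "\<sigma> \<in> carrier grass_Aut" and comm: "parity (\<sigma> a) = \<sigma> (parity a)" for a
    by (simp_all add: Z2gr_iff)
  have "parity ((inv\<^bsub>grass_Aut\<^esub> \<sigma>) a) = (inv\<^bsub>grass_Aut\<^esub> \<sigma>) (parity a)" for a
    using comm[of "(inv\<^bsub>grass_Aut\<^esub> \<sigma>) a"] by (metis Aut_inv(2,3)[OF A])
  then show "inv\<^bsub>grass_Aut\<^esub> \<sigma> \<in> grass_Z2gr" by (simp add: Z2gr_iff Aut_inv(1)[OF A])
next
  fix \<sigma> \<tau> :: "('k, 'n) grass_endo" assume "\<sigma> \<in> grass_Z2gr" "\<tau> \<in> grass_Z2gr"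
  then show "\<sigma> \<otimes>\<^bsub>grass_Aut\<^esub> \<tau> \<in> grass_Z2gr"
    by (auto simp: Z2gr_iff Aut_iff bij_comp grass_hom_comp)
qed

section \<open>The graded automorphisms\<close>

text \<open>For odd elements, lying in the cube of the augmentation ideal means having no linear
  part; the chain rule passes from the generators to all elements.\<close>

lemma Gamma_iff:
  fixes \<sigma> :: "('k, 'n::finite) grass_endo"
  shows "\<sigma> \<in> grass_Gamma \<longleftrightarrow> \<sigma> \<in> grass_Z2gr \<and> (\<forall>k a. lin k (\<sigma> a) = lin k a)"
proof safe
  assume \<sigma>: "\<sigma> \<in> grass_Gamma"
  then have A: "\<sigma> \<in> carrier grass_Aut"
    and od: "\<sigma> (grass_gen i) - grass_gen i \<in> grass_od"
    and cube: "\<sigma> (grass_gen i) - grass_gen i \<in> ideal_mult grass_max (ideal_mult grass_max grass_max)"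
    for i by (auto simp: grass_Gamma_def)
  show "\<sigma> \<in> grass_Z2gr"
    by (rule Z2gr_genI[OF A]) (use od in \<open>simp add: grass_od_iff\<close>)
  fix k a
  have gen: "lin k (\<sigma> (grass_gen i)) = lin k (grass_gen i)" for i
    using max_cube_lin[OF cube, of k i] by (simp only: lin_additive right_minus_eq)
  show "lin k (\<sigma> a) = lin k a"
    using hom_lin'[of \<sigma> k a] hom_lin'[OF grass_hom_id, of k a] A by (simp add: gen Aut_iff)
next
  assume Z: "\<sigma> \<in> grass_Z2gr" and lin: "\<forall>k a. lin k (\<sigma> a) = lin k a"
  then have A: "\<sigma> \<in> carrier grass_Aut" and comm: "parity (\<sigma> a) = \<sigma> (parity a)" for a
    by (simp_all add: Z2gr_iff)
  have od: "\<sigma> (grass_gen i) - grass_gen i \<in> grass_od" for i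
    using A by (simp add: grass_od_iff comm Aut_iff grass_homD(6))
  show "\<sigma> \<in> grass_Gamma" unfolding grass_Gamma_def
    using A od grass_od_max_cube[OF od] lin by (simp del: lin_gen)
qed

text \<open>The coefficient matrix of an automorphism is invertible, its inverse being the matrix of
  linear parts of the inverse automorphism.\<close>

lemma GL_op_iff:
  fixes \<sigma> :: "('k, 'n::finite) grass_endo"
  shows "\<sigma> \<in> grass_GL_op \<longleftrightarrow> \<sigma> \<in> carrier grass_Aut \<and> (\<forall>i. \<sigma> (grass_gen i) \<in> linear_forms)"
proof safe
  assume "\<sigma> \<in> grass_GL_op"
  then show "\<sigma> \<in> carrier grass_Aut" "\<sigma> (grass_gen i) \<in> linear_forms" for i
    by (auto simp: grass_GL_op_def sum_gen_linear_form)
next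
  assume A: "\<sigma> \<in> carrier grass_Aut" and V: "\<forall>i. \<sigma> (grass_gen i) \<in> linear_forms"
  let ?\<tau> = "inv\<^bsub>grass_Aut\<^esub> \<sigma>"
  have hom: "grass_hom \<sigma>" "grass_hom ?\<tau>" using A Aut_inv(1)[OF A] by (simp_all add: Aut_iff)
  define M where "M \<rho> = (\<chi> i j. lin j (\<rho> (grass_gen i)))" for \<rho> :: "('k, 'n) grass_endo"
  \<comment> \<open>By the chain rule \<open>M \<alpha> ** M \<beta>\<close> is the matrix of
    \<open>\<beta> \<circ> \<alpha>\<close>; this reversal is the reason for the opposite
    group.\<close>
  have mult: "M \<alpha> ** M \<beta> = mat 1" if "grass_hom \<beta>" "\<And>a. \<beta> (\<alpha> a) = a" for \<alpha> \<beta>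
    unfolding M_def matrix_matrix_mult_def mat_def vec_eq_iff
    by (simp add: that(2) flip: hom_lin'[OF that(1)])
  have "invertible (M \<sigma>)" unfolding invertible_def
    using mult[of ?\<tau> \<sigma>] mult[of \<sigma> ?\<tau>] hom Aut_inv(2,3)[OF A] by blast
  moreover have "\<sigma> (grass_gen i) = (\<Sum>j\<in>UNIV. grass_scale (M \<sigma> $ i $ j) (grass_gen j))" for i
    using V by (simp add: M_def linear_forms_def)
  ultimately show "\<sigma> \<in> grass_GL_op" using A unfolding grass_GL_op_def by blast
qed

lemma subgroup_GL_op: "subgroup (grass_GL_op :: ('k, 'n::finite) grass_endo set) grass_Aut"
proof (rule group.subgroupI[OF group_grass_Aut])
  show "(grass_GL_op :: ('k, 'n) grass_endo set) \<subseteq> carrier grass_Aut" by (auto simp: GL_op_iff)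
  have "id \<in> (grass_GL_op :: ('k, 'n) grass_endo set)"
    by (simp add: GL_op_iff Aut_iff grass_hom_id gen_linear_form)
  then show "(grass_GL_op :: ('k, 'n) grass_endo set) \<noteq> {}" by blast
next
  fix \<sigma> :: "('k, 'n) grass_endo" assume \<sigma>: "\<sigma> \<in> grass_GL_op"
  let ?\<tau> = "inv\<^bsub>grass_Aut\<^esub> \<sigma>"
  have A: "\<sigma> \<in> carrier grass_Aut" and V: "\<sigma> (grass_gen i) \<in> linear_forms" for i
    using \<sigma> by (simp_all add: GL_op_iff)
  have hom: "grass_hom \<sigma>" using A by (simp add: Aut_iff)
  have "?\<tau> (grass_gen i) \<in> linear_forms" for i
  proof -
    let ?v = "\<Sum>j\<in>UNIV. grass_scale (lin j (?\<tau> (grass_gen i))) (grass_gen j)"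
    \<comment> \<open>\<open>?v\<close> is the linear part of the preimage; its image is a linear
      form with the coefficients of the generator, so \<open>?v\<close> is the preimage
      itself.\<close>
    have eq: "\<sigma> ?v = grass_gen i"
    proof (rule linear_forms_eqI)
      show "\<sigma> ?v \<in> linear_forms" by (rule hom_linear_forms[OF hom V sum_gen_linear_form])
      show "lin k (\<sigma> ?v) = lin k (grass_gen i)" for k
        using hom_lin'[OF hom, of k ?v] hom_lin'[OF hom, of k "?\<tau> (grass_gen i)"]
        by (simp only: lin_sum_gen Aut_inv(2)[OF A])
    qed (rule gen_linear_form)
    have "?\<tau> (grass_gen i) = ?v" using Aut_inv(3)[OF A, of ?v] unfolding eq .
    then show ?thesis by (metis sum_gen_linear_form)
  qed
  then show "?\<tau> \<in> grass_GL_op" by (simp add: GL_op_iff Aut_inv(1)[OF A])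
next
  fix \<sigma> \<tau> :: "('k, 'n) grass_endo" assume *: "\<sigma> \<in> grass_GL_op" "\<tau> \<in> grass_GL_op"
  then have "\<sigma> (\<tau> (grass_gen i)) \<in> linear_forms" for i
    using hom_linear_forms[of \<sigma> "\<tau> (grass_gen i)"] by (simp add: GL_op_iff Aut_iff)
  with * show "\<sigma> \<otimes>\<^bsub>grass_Aut\<^esub> \<tau> \<in> grass_GL_op"
    by (simp add: GL_op_iff Aut_iff bij_comp grass_hom_comp)
qed

text \<open>Truncating the images of the generators to their linear parts gives a homomorphism;
  truncating the inverse automorphism in the same way gives its inverse.\<close>

lemma linear_part_exists:
  fixes \<sigma> :: "('k, 'n::finite) grass_endo"
  assumes "\<sigma> \<in> carrier grass_Aut"
  obtains \<alpha> where "\<alpha> \<in> grass_GL_op" "\<And>k a. lin k (\<alpha> a) = lin k (\<sigma> a)"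
proof -
  let ?\<tau> = "inv\<^bsub>grass_Aut\<^esub> \<sigma>"
  have hom: "grass_hom \<sigma>" "grass_hom ?\<tau>"
    using assms Aut_inv(1)[OF assms] by (simp_all add: Aut_iff)
  have ex: "\<exists>\<alpha>. grass_hom \<alpha> \<and> (\<forall>i. \<alpha> (grass_gen i) \<in> linear_forms)
      \<and> (\<forall>k a. lin k (\<alpha> a) = lin k (\<rho> a))"
    if \<rho>: "grass_hom \<rho>" for \<rho> :: "('k, 'n) grass_endo"
  proof -
    define y where "y i = (\<Sum>j\<in>UNIV. grass_scale (lin j (\<rho> (grass_gen i))) (grass_gen j))" for i
    have y: "y i \<in> linear_forms" for i by (simp add: y_def sum_gen_linear_form)
    \<comment> \<open>Linear forms are odd, so they satisfy the Grassmann relations.\<close>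
    have "y i * y i = 0" "y i * y j + y j * y i = 0" for i j
      using parity_odd_square parity_odd_anticomm linear_forms_odd[OF y]
      by (auto simp: eq_neg_iff_add_eq_0)
    then obtain \<alpha> where \<alpha>: "grass_hom \<alpha>" "\<And>i. \<alpha> (grass_gen i) = y i"
      using grass_hom_exists[of y] by blast
    have "lin k (\<alpha> a) = lin k (\<rho> a)" for k a
      using hom_lin'[OF \<alpha>(1), of k a] hom_lin'[OF \<rho>, of k a] by (simp only: \<alpha>(2) y_def lin_sum_gen)
    with \<alpha> y show ?thesis by auto
  qed
  obtain \<alpha> where \<alpha>: "grass_hom \<alpha>" "\<And>i. \<alpha> (grass_gen i) \<in> linear_forms"
      "\<And>k a. lin k (\<alpha> a) = lin k (\<sigma> a)"
    using ex[OF hom(1)] by blast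
  obtain \<beta> where \<beta>: "grass_hom \<beta>" "\<And>i. \<beta> (grass_gen i) \<in> linear_forms"
      "\<And>k a. lin k (\<beta> a) = lin k (?\<tau> a)"
    using ex[OF hom(2)] by blast
  \<comment> \<open>Stated for arbitrary pairs because it is used in both orders; the primed maps
    are the untruncated ones, whose composite is the identity.\<close>
  have inverse: "\<phi> \<circ> \<psi> = id"
    if "grass_hom \<phi>" "\<And>i. \<phi> (grass_gen i) \<in> linear_forms" "\<And>k a. lin k (\<phi> a) = lin k (\<phi>' a)"
      "grass_hom \<psi>" "\<And>i. \<psi> (grass_gen i) \<in> linear_forms" "\<And>k a. lin k (\<psi> a) = lin k (\<psi>' a)"
      "grass_hom \<phi>'" "\<And>a. \<phi>' (\<psi>' a) = a"
    for \<phi> \<psi> \<phi>' \<psi>' :: "('k, 'n) grass_endo"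
  proof (rule grass_hom_eqI)
    fix i
    have "\<phi> (\<psi> (grass_gen i)) = grass_gen i"
    proof (rule linear_forms_eqI)
      show "\<phi> (\<psi> (grass_gen i)) \<in> linear_forms" by (rule hom_linear_forms) (fact that)+
      fix k
      have "lin k (\<phi> (\<psi> (grass_gen i))) = lin k (\<phi>' (\<psi>' (grass_gen i)))"
        by (simp only: that(3,6) hom_lin'[OF that(7), of k "\<psi> (grass_gen i)"]
            hom_lin'[OF that(7), of k "\<psi>' (grass_gen i)"])
      then show "lin k (\<phi> (\<psi> (grass_gen i))) = lin k (grass_gen i)" by (simp only: that(8))
    qed (rule gen_linear_form)
    then show "(\<phi> \<circ> \<psi>) (grass_gen i) = id (grass_gen i)" by simp
  qed (simp_all add: grass_hom_comp grass_hom_id that)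
  have "\<alpha> \<circ> \<beta> = id" by (rule inverse[OF \<alpha> \<beta> hom(1)]) (rule Aut_inv(2)[OF assms])
  moreover have "\<beta> \<circ> \<alpha> = id" by (rule inverse[OF \<beta> \<alpha> hom(2)]) (rule Aut_inv(3)[OF assms])
  ultimately have "bij \<alpha>" using o_bij by blast
  then have "\<alpha> \<in> grass_GL_op" using \<alpha> by (simp add: GL_op_iff Aut_iff)
  then show thesis using \<alpha>(3) that by blast
qed

text \<open>\<open>grass_Gamma\<close> is the kernel of taking linear parts on graded automorphisms,
  and \<open>grass_GL_op\<close> is a section of that map.\<close>

lemma semidirect_Z2gr:
  "internal_semidirect ((grass_Aut :: ('k, 'n::finite) grass_endo monoid)\<lparr>carrier := grass_Z2gr\<rparr>)
     grass_Gamma grass_GL_op"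
proof -
  interpret G: group "grass_Aut :: ('k, 'n) grass_endo monoid" by (rule group_grass_Aut)
  let ?Z = "(grass_Aut :: ('k, 'n) grass_endo monoid)\<lparr>carrier := grass_Z2gr\<rparr>"
  interpret Z: subgroup "grass_Z2gr :: ('k, 'n) grass_endo set" grass_Aut by (rule subgroup_Z2gr)
  interpret ZG: group ?Z by (rule Z.subgroup_is_group[OF group_grass_Aut])
  have inv_Z: "inv\<^bsub>?Z\<^esub> \<sigma> = inv\<^bsub>grass_Aut\<^esub> \<sigma>" if "\<sigma> \<in> grass_Z2gr" for \<sigma> :: "('k, 'n) grass_endo"
    using G.m_inv_consistent[OF subgroup_Z2gr that] by simp
  have lin_inv: "lin k ((inv\<^bsub>grass_Aut\<^esub> \<sigma>) a) = lin k a" if "\<sigma> \<in> grass_Gamma"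
    for k a and \<sigma> :: "('k, 'n) grass_endo"
  proof -
    have A: "\<sigma> \<in> carrier grass_Aut" using that by (simp add: Gamma_iff Z2gr_iff)
    have "lin k (\<sigma> ((inv\<^bsub>grass_Aut\<^esub> \<sigma>) a)) = lin k ((inv\<^bsub>grass_Aut\<^esub> \<sigma>) a)"
      using that by (simp only: Gamma_iff)
    then show ?thesis by (simp only: Aut_inv(2)[OF A])
  qed
  have sub_Gamma: "subgroup (grass_Gamma :: ('k, 'n) grass_endo set) grass_Aut"
  proof (rule G.subgroupI)
    show "(grass_Gamma :: ('k, 'n) grass_endo set) \<subseteq> carrier grass_Aut"
      by (auto simp: Gamma_iff Z2gr_iff)
    have "id \<in> (grass_Gamma :: ('k, 'n) grass_endo set)"
      using Z.one_closed by (simp add: Gamma_iff)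
    then show "(grass_Gamma :: ('k, 'n) grass_endo set) \<noteq> {}" by blast
    fix \<sigma> :: "('k, 'n) grass_endo" assume \<sigma>: "\<sigma> \<in> grass_Gamma"
    then show "inv\<^bsub>grass_Aut\<^esub> \<sigma> \<in> grass_Gamma"
      using Z.m_inv_closed[of \<sigma>] lin_inv[OF \<sigma>] by (simp add: Gamma_iff)
    fix \<tau> :: "('k, 'n) grass_endo" assume "\<tau> \<in> grass_Gamma"
    then show "\<sigma> \<otimes>\<^bsub>grass_Aut\<^esub> \<tau> \<in> grass_Gamma"
      using \<sigma> Z.m_closed[of \<sigma> \<tau>] by (simp add: Gamma_iff)
  qed
  have GL_Z: "grass_GL_op \<subseteq> (grass_Z2gr :: ('k, 'n) grass_endo set)"
    by (auto simp: GL_op_iff linear_forms_odd intro!: Z2gr_genI)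
  have "grass_Gamma \<lhd> ?Z" unfolding ZG.normal_inv_iff
  proof (intro conjI ballI)
    show "subgroup grass_Gamma ?Z"
      by (rule G.subgroup_incl[OF sub_Gamma subgroup_Z2gr]) (auto simp: Gamma_iff)
    fix \<sigma> \<gamma> :: "('k, 'n) grass_endo" assume "\<sigma> \<in> carrier ?Z" and \<gamma>: "\<gamma> \<in> grass_Gamma"
    then have \<sigma>: "\<sigma> \<in> grass_Z2gr" by simp
    then have A: "\<sigma> \<in> carrier grass_Aut" by (simp add: Z2gr_iff)
    have hom: "grass_hom \<sigma>" using A by (simp add: Aut_iff)
    have "\<sigma> \<circ> \<gamma> \<circ> inv\<^bsub>grass_Aut\<^esub> \<sigma> \<in> grass_Z2gr"
      using Z.m_closed[OF Z.m_closed[OF \<sigma>, of \<gamma>] Z.m_inv_closed[OF \<sigma>]] \<gamma> by (simp add: Gamma_iff)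
    moreover have "lin k (\<sigma> (\<gamma> ((inv\<^bsub>grass_Aut\<^esub> \<sigma>) a))) = lin k a" for k a
    proof -
      have "lin k (\<sigma> (\<gamma> b)) = lin k (\<sigma> b)" for b
        using hom_lin'[OF hom, of k "\<gamma> b"] hom_lin'[OF hom, of k b] \<gamma> by (simp only: Gamma_iff)
      then show ?thesis by (simp only: Aut_inv(2)[OF A])
    qed
    ultimately show "\<sigma> \<otimes>\<^bsub>?Z\<^esub> \<gamma> \<otimes>\<^bsub>?Z\<^esub> inv\<^bsub>?Z\<^esub> \<sigma> \<in> grass_Gamma"
      by (simp add: inv_Z[OF \<sigma>] Gamma_iff)
  qed
  moreover have "subgroup grass_GL_op ?Z"
    by (rule G.subgroup_incl[OF subgroup_GL_op subgroup_Z2gr GL_Z])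
  moreover have "grass_Gamma \<inter> grass_GL_op = {\<one>\<^bsub>?Z\<^esub>}"
  proof
    show "grass_Gamma \<inter> grass_GL_op \<subseteq> {\<one>\<^bsub>?Z\<^esub>}"
    proof
      fix \<sigma> :: "('k, 'n) grass_endo" assume \<sigma>: "\<sigma> \<in> grass_Gamma \<inter> grass_GL_op"
      have "\<sigma> = id"
      proof (rule grass_hom_eqI)
        show "grass_hom \<sigma>" using \<sigma> by (simp add: GL_op_iff Aut_iff)
        fix i
        have "\<sigma> (grass_gen i) = grass_gen i"
          by (rule linear_forms_eqI) (use \<sigma> in \<open>simp_all add: GL_op_iff Gamma_iff gen_linear_form\<close>)
        then show "\<sigma> (grass_gen i) = id (grass_gen i)" by simp
      qed (rule grass_hom_id)
      then show "\<sigma> \<in> {\<one>\<^bsub>?Z\<^esub>}" by simp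
    qed
    show "{\<one>\<^bsub>?Z\<^esub>} \<subseteq> grass_Gamma \<inter> grass_GL_op"
      using subgroup.one_closed[OF sub_Gamma] subgroup.one_closed[OF subgroup_GL_op] by simp
  qed
  moreover have "grass_Gamma <#>\<^bsub>?Z\<^esub> grass_GL_op = carrier ?Z"
  proof
    show "grass_Gamma <#>\<^bsub>?Z\<^esub> grass_GL_op \<subseteq> carrier ?Z"
      using GL_Z Z.m_closed by (auto simp: set_mult_def Gamma_iff)
    show "carrier ?Z \<subseteq> grass_Gamma <#>\<^bsub>?Z\<^esub> grass_GL_op"
    proof
      fix \<sigma> assume "\<sigma> \<in> carrier ?Z"
      then have \<sigma>: "\<sigma> \<in> grass_Z2gr" by simp
      then have A: "\<sigma> \<in> carrier grass_Aut" by (simp add: Z2gr_iff)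
      obtain \<alpha> where \<alpha>: "\<alpha> \<in> grass_GL_op" "\<And>k a. lin k (\<alpha> a) = lin k (\<sigma> a)"
        using linear_part_exists[OF A] by blast
      have A\<alpha>: "\<alpha> \<in> carrier grass_Aut" using \<alpha>(1) by (simp add: GL_op_iff)
      \<comment> \<open>Dividing by the linear part of \<open>\<sigma>\<close> leaves an
        automorphism with trivial linear part.\<close>
      define \<gamma> where "\<gamma> = \<sigma> \<circ> inv\<^bsub>grass_Aut\<^esub> \<alpha>"
      have "\<gamma> \<in> grass_Z2gr"
        using Z.m_closed[OF \<sigma> Z.m_inv_closed[of \<alpha>]] \<alpha>(1) GL_Z by (auto simp: \<gamma>_def)
      moreover have "lin k (\<gamma> a) = lin k a" for k a
        by (simp add: \<gamma>_def Aut_inv(2)[OF A\<alpha>] flip: \<alpha>(2))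
      ultimately have "\<gamma> \<in> grass_Gamma" by (simp add: Gamma_iff)
      moreover have "\<sigma> = \<gamma> \<otimes>\<^bsub>?Z\<^esub> \<alpha>" by (simp add: \<gamma>_def fun_eq_iff Aut_inv(3)[OF A\<alpha>])
      ultimately show "\<sigma> \<in> grass_Gamma <#>\<^bsub>?Z\<^esub> grass_GL_op"
        using \<alpha>(1) unfolding set_mult_def by blast
    qed
  qed
  ultimately show ?thesis by (simp add: internal_semidirect_def)
qed

end

section \<open>Inner automorphisms\<close>

context half_ring
begin

lemma odd_unipotent_inverse:
  fixes a :: "('k, 'n) grassmann"
  assumes "parity a = - a"
  shows "(1 + a) * (1 - a) = 1" "(1 - a) * (1 + a) = 1"
  using parity_odd_square[OF assms] by (simp_all add: distrib_left distrib_right left_diff_distrib right_diff_distrib)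

text \<open>Expanding \<open>(1 + a) * u * (1 - a)\<close>, the term \<open>a * u * a\<close>
  vanishes since \<open>a * a = 0\<close>, and \<open>- (u * a)\<close> equals
  \<open>a * u\<close>.\<close>

lemma inner_odd:
  fixes a u :: "('k, 'n) grassmann"
  assumes "parity a = - a" "parity u = - u"
  shows "grass_inner (1 + a) u = u + (a * u + a * u)"
proof -
  have ua: "u * a = - (a * u)" by (rule parity_odd_anticomm[OF assms(2,1)])
  have "a * (u * a) = 0"
    unfolding ua using parity_odd_square[OF assms(1)] by (simp flip: mult.assoc)
  with ua show ?thesis
    by (simp add: grass_inner_eq[OF odd_unipotent_inverse[OF assms(1)]] distrib_right
        right_diff_distrib mult.assoc)
qed

lemma inner_even:
  fixes a e :: "('k, 'n) grassmann"
  assumes "parity a = - a" "parity e = e"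
  shows "grass_inner (1 + a) e = e"
  by (simp add: grass_inner_eq[OF odd_unipotent_inverse[OF assms(1)]] mult.assoc
      odd_unipotent_inverse[OF assms(1)] flip: parity_even_central[OF assms(2)])

lemma Omega_eq_Inn: "(grass_Omega :: ('k, 'n) grass_endo set) = grass_Inn"
proof
  show "(grass_Omega :: ('k, 'n) grass_endo set) \<subseteq> grass_Inn"
    unfolding grass_Omega_def grass_Inn_def grass_unit_def
    using odd_unipotent_inverse by (auto simp: grass_od_iff)
  show "(grass_Inn :: ('k, 'n) grass_endo set) \<subseteq> grass_Omega"
  proof
    fix \<sigma> :: "('k, 'n) grass_endo" assume "\<sigma> \<in> grass_Inn"
    then obtain w v where \<sigma>: "\<sigma> = grass_inner w" and wv: "w * v = 1" "v * w = 1"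
      by (auto simp: grass_Inn_def grass_unit_def)
    obtain e u where w: "w = e + u" and e: "parity e = e" and u: "parity u = - u"
      using parity_decomp .
    note central = parity_even_central[OF e]
    have pw: "parity w * parity v = 1"
      using arg_cong[OF wv(1), of parity] by simp
    \<comment> \<open>This is \<open>(e + u) * (e - u)\<close>; the mixed terms cancel because
      \<open>e\<close> is central. As a product of units it makes \<open>e\<close>
      invertible.\<close>
    have "w * parity w = e * e"
      using parity_odd_square[OF u] central[of u]
      by (simp add: w e u distrib_left distrib_right left_diff_distrib right_diff_distrib)
    moreover have "w * parity w * (parity v * v) = 1"
      using pw wv(1) by (metis mult.assoc mult.left_neutral)
    ultimately have inv: "e * (e * (parity v * v)) = 1" by (simp add: mult.assoc)
    define r where "r = e * (parity v * v)"
    have er: "e * r = 1" by (simp add: r_def inv)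
    then have re: "r * e = 1" by (simp only: central)
    \<comment> \<open>Both \<open>r\<close> and \<open>parity r\<close> invert \<open>e\<close>, so
      \<open>r\<close> is even.\<close>
    have "e * parity r = 1" using arg_cong[OF er, of parity] e by simp
    then have r: "parity r = r" using re by (metis mult.assoc mult.left_neutral mult.right_neutral)
    define a where "a = r * u"
    have a: "parity a = - a" by (simp add: a_def r u)
    have wa: "w = e * (1 + a)"
      using er by (simp add: w a_def distrib_left flip: mult.assoc)
    have cancel: "(1 + a) * ((1 - a) * x) = x" "r * (e * x) = x" for x
      using odd_unipotent_inverse[OF a] re by (simp_all flip: mult.assoc)
    have inverse: "w * ((1 - a) * r) = 1" "((1 - a) * r) * w = 1"
      by (simp_all only: wa mult.assoc cancel er odd_unipotent_inverse[OF a])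
    have "\<sigma> = grass_inner (1 + a)"
    proof
      fix x
      have "\<sigma> x = e * ((1 + a) * x * (1 - a) * r)"
        by (simp add: \<sigma> grass_inner_eq[OF inverse]) (simp add: wa mult.assoc)
      also have "\<dots> = (1 + a) * x * (1 - a) * (r * e)"
        by (simp only: central mult.assoc)
      finally show "\<sigma> x = grass_inner (1 + a) x"
        by (simp add: re grass_inner_eq[OF odd_unipotent_inverse[OF a]])
    qed
    with a show "\<sigma> \<in> grass_Omega" by (auto simp: grass_Omega_def grass_od_iff)
  qed
qed

lemma eq_uminus_imp_zero: "c = 0" if "c = - c" for c :: 'k
proof -
  have "2 * c = 0" using that unfolding eq_neg_iff_add_eq_0 mult_2 .
  then have "(2 * h) * c = 0" by (simp only: mult.assoc mult.left_commute[of 2 h] mult_zero_right)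
  then show ?thesis by (simp add: half)
qed

lemma even_lin:
  fixes e :: "('k, 'n) grassmann"
  assumes "parity e = e"
  shows "lin k e = 0"
  by (rule eq_uminus_imp_zero) (use lin_parity[of k e] in \<open>simp only: assms\<close>)

lemma odd_counit:
  fixes u :: "('k, 'n) grassmann"
  assumes "parity u = - u"
  shows "counit u = 0"
  by (rule eq_uminus_imp_zero) (metis assms counit_additive(2) counit_parity)

end

section \<open>Removing the even parts of the images of the generators\<close>

context reduced_half_ring
begin

lemma Aut_even_part:
  fixes \<sigma> :: "('k, 'n::finite) grass_endo"
  assumes A: "\<sigma> \<in> carrier grass_Aut"
    and \<sigma>: "\<And>i. \<sigma> (grass_gen i) = e i + u i"
    and e: "\<And>i. parity (e i) = e i" and u: "\<And>i. parity (u i) = - u i"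
  obtains a where "parity a = - a" "\<And>i. e i = a * u i"
proof -
  let ?\<tau> = "inv\<^bsub>grass_Aut\<^esub> \<sigma>"
  have hom: "grass_hom \<sigma>" "grass_hom ?\<tau>"
    using A Aut_inv(1)[OF A] by (simp_all add: Aut_iff)
  \<comment> \<open>These are the even and odd components of the relation between the images of two
    generators, which vanish separately; \<open>i = j\<close> is included.\<close>
  have rel: "e i * e j = 0 \<and> e i * u j = - (e j * u i)" for i j
  proof -
    have "grass_gen i * grass_gen j + grass_gen j * grass_gen i = (0 :: ('k, 'n) grassmann)"
      using grass_gen_anticomm'[of i j] by (simp only: eq_neg_iff_add_eq_0)
    then have "\<sigma> (grass_gen i * grass_gen j + grass_gen j * grass_gen i) = 0"
      by (simp only: grass_homD(5)[OF hom(1)])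
    then have "(e i + u i) * (e j + u j) + (e j + u j) * (e i + u i) = 0"
      by (simp only: grass_homD(1,4)[OF hom(1)] \<sigma>)
    moreover have "(e i + u i) * (e j + u j) + (e j + u j) * (e i + u i)
        = (e i * e j + e i * e j) + ((e i * u j + e j * u i) + (e i * u j + e j * u i))"
      using parity_even_central[OF e, of j "e i"] parity_even_central[OF e, of j "u i"]
        parity_even_central[OF e, of i "u j"] parity_odd_anticomm[OF u u, of j i]
      by (simp add: distrib_left distrib_right)
    ultimately have "(e i * e j + e i * e j) + ((e i * u j + e j * u i) + (e i * u j + e j * u i)) = 0 + 0"
      by simp
    then have "e i * e j + e i * e j = 0"
      and "(e i * u j + e j * u i) + (e i * u j + e j * u i) = 0"
      by (rule parity_unique; simp add: e u)+
    then show ?thesis using double_eq_0 eq_neg_iff_add_eq_0 by blast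
  qed
  \<comment> \<open>Pulling back along the inverse replaces the images of the generators by the
    generators themselves, so that \<open>gen_mult_system\<close> applies.\<close>
  define f where "f i = ?\<tau> (e i)" for i
  have gf: "grass_gen i * f j = ?\<tau> (e j * u i)" for i j
  proof -
    have "grass_gen i * f j = ?\<tau> (\<sigma> (grass_gen i) * e j)"
      by (simp only: f_def grass_homD(4)[OF hom(2)] Aut_inv(3)[OF A])
    also have "\<sigma> (grass_gen i) * e j = e j * (e i + u i)"
      unfolding \<sigma>[symmetric] by (rule parity_even_central[OF e, symmetric])
    also have "\<dots> = e j * u i"
      using conjunct1[OF rel, of j i] by (simp add: distrib_left)
    finally show ?thesis .
  qed
  have f_anti: "grass_gen i * f j = - (grass_gen j * f i)" for i j
    unfolding gf using rel[of j i] by (simp add: grass_homD(6)[OF hom(2)])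
  have f_zero: "grass_gen i * f i = 0" for i
    by (rule double_eq_0, rule eq_neg_iff_add_eq_0[THEN iffD1], rule f_anti)
  obtain b where "\<And>i. i \<in> UNIV \<Longrightarrow> f i = grass_gen i * b"
    using gen_mult_system[of UNIV f, OF finite f_zero f_anti] by blast
  then have b: "f i = grass_gen i * b" for i by blast
  \<comment> \<open>The constant term of \<open>b\<close> is a linear coefficient of the pullback of
    an even element, and even elements have no linear part.\<close>
  have "counit b = lin i (?\<tau> (e i))" for i
    using b[of i] by (simp add: f_def)
  moreover have "lin i (?\<tau> (e i)) = 0" for i
    using hom_lin'[OF hom(2), of i "e i"] by (simp add: even_lin[OF e])
  ultimately have "counit b = 0" by simp
  then have "counit (\<sigma> b) = 0"
    using hom_counit[OF hom(1) hom_counit_gen[OF hom(1)]] by simp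
  moreover obtain p q where pq: "\<sigma> b = p + q" "parity p = p" "parity q = - q"
    using parity_decomp .
  \<comment> \<open>An odd \<open>q\<close> has no constant term, so that of
    \<open>\<sigma> b\<close> is carried by \<open>p\<close>; its vanishing makes
    \<open>1 - p\<close> invertible.\<close>
  ultimately have "counit p = 0" using odd_counit[OF pq(3)] by simp
  then obtain r where r: "r * (1 - p) = 1" "parity r = r"
    using even_unipotent_inverse pq(2) by blast
  show thesis
  proof
    \<comment> \<open>The witness solves \<open>e i * (1 - p) = u i * q\<close> for
      \<open>e i\<close>; its sign comes from exchanging the odd elements \<open>u i\<close> and
      \<open>q\<close>.\<close>
    show "parity (- (r * q)) = - (- (r * q))" by (simp add: r pq)
    fix i
    have "e i = \<sigma> (f i)" by (simp add: f_def Aut_inv(2)[OF A])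
    also have "\<dots> = (e i + u i) * (p + q)" by (simp only: b grass_homD(4)[OF hom(1)] \<sigma> pq(1))
    finally have "e i + 0 = (e i * p + u i * q) + (e i * q + u i * p)"
      by (simp add: distrib_left distrib_right ac_simps)
    then have "e i = e i * p + u i * q"
      by (rule parity_unique(1)) (simp_all add: e u pq)
    then have "e i * (1 - p) = u i * q" by (simp add: right_diff_distrib algebra_simps)
    then have "e i * (1 - p) = - (q * u i)" using parity_odd_anticomm[OF u pq(3)] by simp
    then have "r * (e i * (1 - p)) = - (r * q) * u i" by (simp add: mult.assoc)
    moreover have "r * (e i * (1 - p)) = e i * (r * (1 - p))"
      by (simp only: parity_even_central[OF r(2), of "e i"] flip: mult.assoc)
    ultimately show "e i = - (r * q) * u i" by (simp add: r(1))
  qed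
qed

lemma semidirect_Aut:
  "internal_semidirect (grass_Aut :: ('k, 'n::finite) grass_endo monoid) grass_Omega grass_Z2gr"
proof -
  have Omega_Aut: "(grass_Omega :: ('k, 'n) grass_endo set) \<subseteq> carrier grass_Aut"
    unfolding Omega_eq_Inn by (auto simp: grass_Inn_def grass_inner_Aut)
  have Z_Aut: "(grass_Z2gr :: ('k, 'n) grass_endo set) \<subseteq> carrier grass_Aut"
    by (auto simp: Z2gr_iff)
  have normal: "(grass_Omega :: ('k, 'n) grass_endo set) \<lhd> grass_Aut"
    unfolding Omega_eq_Inn by (rule normal_grass_Inn)
  have "grass_Omega \<inter> grass_Z2gr = {\<one>\<^bsub>(grass_Aut :: ('k, 'n) grass_endo monoid)\<^esub>}"
  proof
    show "grass_Omega \<inter> grass_Z2gr \<subseteq> {\<one>\<^bsub>(grass_Aut :: ('k, 'n) grass_endo monoid)\<^esub>}"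
    proof
      fix \<sigma> :: "('k, 'n) grass_endo" assume \<sigma>: "\<sigma> \<in> grass_Omega \<inter> grass_Z2gr"
      then obtain a where a: "parity a = - a" "\<sigma> = grass_inner (1 + a)"
        by (auto simp: grass_Omega_def grass_od_iff)
      have A: "\<sigma> \<in> carrier grass_Aut" and comm: "parity (\<sigma> x) = \<sigma> (parity x)" for x
        using \<sigma> by (simp_all add: Z2gr_iff)
      have hom: "grass_hom \<sigma>" using A by (simp add: Aut_iff)
      have "\<sigma> = id"
      proof (rule grass_hom_eqI[OF hom grass_hom_id])
        fix i
        \<comment> \<open>A graded \<open>\<sigma>\<close> sends the generator to an odd element, so
          the even summand produced by the conjugation must vanish.\<close>
        have "0 + \<sigma> (grass_gen i) = (a * grass_gen i + a * grass_gen i) + grass_gen i"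
          by (simp add: a(2) inner_odd[OF a(1)] add.commute)
        then have "\<sigma> (grass_gen i) = grass_gen i"
          by (rule parity_unique(2)) (simp_all add: comm a(1) grass_homD(6)[OF hom])
        then show "\<sigma> (grass_gen i) = id (grass_gen i)" by simp
      qed
      then show "\<sigma> \<in> {\<one>\<^bsub>(grass_Aut :: ('k, 'n) grass_endo monoid)\<^esub>}" by simp
    qed
    show "{\<one>\<^bsub>(grass_Aut :: ('k, 'n) grass_endo monoid)\<^esub>} \<subseteq> grass_Omega \<inter> grass_Z2gr"
      using subgroup.one_closed[OF normal_imp_subgroup[OF normal]]
        subgroup.one_closed[OF subgroup_Z2gr] by simp
  qed
  moreover have "grass_Omega <#>\<^bsub>grass_Aut\<^esub> grass_Z2gr
      = carrier (grass_Aut :: ('k, 'n) grass_endo monoid)"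
  proof
    show "grass_Omega <#>\<^bsub>grass_Aut\<^esub> grass_Z2gr
        \<subseteq> carrier (grass_Aut :: ('k, 'n) grass_endo monoid)"
      using Omega_Aut Z_Aut
      by (auto simp: set_mult_def Aut_iff subset_iff intro!: bij_comp grass_hom_comp)
    show "carrier (grass_Aut :: ('k, 'n) grass_endo monoid)
        \<subseteq> grass_Omega <#>\<^bsub>grass_Aut\<^esub> grass_Z2gr"
    proof
      fix \<sigma> :: "('k, 'n) grass_endo" assume A: "\<sigma> \<in> carrier grass_Aut"
      have "\<exists>e u. \<sigma> (grass_gen i) = e + u \<and> parity e = e \<and> parity u = - u" for i
        by (rule parity_decomp[of "\<sigma> (grass_gen i)"]) blast
      then obtain e u where eu: "\<And>i. \<sigma> (grass_gen i) = e i + u i"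
        "\<And>i. parity (e i) = e i" "\<And>i. parity (u i) = - u i" by metis
      obtain a where a: "parity a = - a" and ea: "\<And>i. e i = a * u i"
        using Aut_even_part[OF A eu] by blast
      \<comment> \<open>Conjugation by \<open>1 - c\<close> subtracts \<open>c * u i\<close> twice,
        hence the halving of \<open>a\<close>.\<close>
      define c where "c = grass_scale h a"
      have c: "parity c = - c" "parity (- c) = - (- c)" by (simp_all add: c_def a)
      have cc: "c + c = a" unfolding c_def grass.scale_right_distrib[symmetric] by (rule scale_half_double)
      define \<omega> where "\<omega> = (grass_inner (1 + - c) :: ('k, 'n) grass_endo)"
      define \<rho> where "\<rho> = \<omega> \<circ> \<sigma>"
      have \<omega>: "\<omega> \<in> carrier grass_Aut" unfolding \<omega>_def
        by (rule grass_inner_Aut) (use odd_unipotent_inverse[OF c(2)] in \<open>auto simp: grass_unit_def\<close>)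
      then have hom_\<omega>: "grass_hom \<omega>" by (simp add: Aut_iff)
      have "\<rho> (grass_gen i) = u i" for i
      proof -
        have "\<rho> (grass_gen i) = e i + (u i + (- c * u i + - c * u i))"
          unfolding \<rho>_def comp_apply eu(1) grass_homD(1)[OF hom_\<omega>]
          unfolding \<omega>_def inner_even[OF c(2) eu(2)] inner_odd[OF c(2) eu(3)] ..
        also have "- c * u i + - c * u i = - e i"
          by (simp add: ea flip: cc) (simp add: distrib_right)
        finally show ?thesis by simp
      qed
      moreover have "\<rho> \<in> carrier grass_Aut"
        using A \<omega> by (simp add: \<rho>_def Aut_iff bij_comp grass_hom_comp)
      ultimately have "\<rho> \<in> grass_Z2gr" by (intro Z2gr_genI) (simp_all add: eu(3))
      \<comment> \<open>Conjugation by \<open>1 + c\<close> undoes \<open>\<omega>\<close>, because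
        \<open>1 + c\<close> and \<open>1 - c\<close> are mutually inverse.\<close>
      moreover have "\<sigma> = grass_inner (1 + c) \<circ> \<rho>"
      proof
        fix x
        show "\<sigma> x = (grass_inner (1 + c) \<circ> \<rho>) x"
          using odd_unipotent_inverse[OF c(1)]
          by (simp add: \<rho>_def \<omega>_def grass_inner_eq[OF odd_unipotent_inverse[OF c(1)]]
              grass_inner_eq[OF odd_unipotent_inverse(2,1)[OF c(1)]] mult.assoc)
            (simp flip: mult.assoc)
      qed
      moreover have "grass_inner (1 + c) \<in> grass_Omega"
        using c(1) by (auto simp: grass_Omega_def grass_od_iff)
      ultimately show "\<sigma> \<in> grass_Omega <#>\<^bsub>grass_Aut\<^esub> grass_Z2gr"
        by (auto simp: set_mult_def)
    qed
  qed
  ultimately show ?thesis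
    using normal subgroup_Z2gr by (simp add: internal_semidirect_def)
qed

end

theorem corollary2p15:
  assumes reduced: "\<forall>(a::'k::comm_ring_1) m. a ^ m = 0 \<longrightarrow> a = 0"
    and half: "\<exists>h::'k. 2 * h = 1"
  shows
    "internal_semidirect
       ((grass_Aut :: ('k, 'n::finite) grass_endo monoid)\<lparr>carrier := grass_Z2gr\<rparr>)
       grass_Gamma grass_GL_op
     \<and> internal_semidirect
       (grass_Aut :: ('k, 'n) grass_endo monoid) grass_Omega grass_Z2gr
     \<and> (grass_Out :: ('k, 'n) grass_endo set monoid)
       \<cong> (grass_Aut :: ('k, 'n) grass_endo monoid)\<lparr>carrier := grass_Z2gr\<rparr>"
proof -
  from half obtain h :: 'k where "2 * h = 1" ..
  then interpret reduced_half_ring h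
    using reduced by unfold_locales auto
  show ?thesis
    \<comment> \<open>The outer group is a quotient by \<open>grass_Inn\<close>; rewriting with
      \<open>Omega_eq_Inn\<close> identifies it with the quotient by the normal factor of the second
      decomposition.\<close>
    using semidirect_Z2gr semidirect_Aut
      group.semidirect_quotient_iso[OF group_grass_Aut semidirect_Aut]
    by (simp add: grass_Out_def Omega_eq_Inn)
qed

end
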